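(* Let $a,b\in\mathbf{C}$ with $0<|b|<|a|$, let $\kappa>5/2$, and let $\delta=\delta(N)\asymp N^{-\kappa}$, i.e. $C_0^{-1}N^{-\kappa}\le\delta\le C_0N^{-\kappa}$ for a fixed constant $C_0\ge 1$. Let $P_\delta=P_{\mathrm I}+\delta Q_\omega$ be the randomly perturbed $N\times N$ matrix defined in the context, and let $\delta_0>0$ be small and fixed. Let $\Gamma$ be any fixed ($N$-independent) neighborhood of the ellipse $E_1=P_{\mathrm I}(S^1)$. Then there exist constants $C>0$ and $N_0$ such that for all $N\ge N_0$, with probability $$\ge 1-C(\ln N)N^{2\kappa}e^{-2N^{\delta_0}},$$ we have $$\#\big(\sigma(P_\delta)\cap(\mathbf{C}\setminus\Gamma)\big)\le C\,N^{\delta_0}\ln N.$$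
   Context: For $a,b\in\mathbf{C}\setminus\{0\}$, $P_{\mathrm I}$ denotes the $N\times N$ Toeplitz matrix with all entries $(j,j+1)$ equal to $a$, all entries $(j+1,j)$ equal to $b$ ($1\le j\le N-1$), and all other entries $0$. Its symbol is $P_{\mathrm I}(\xi)=ae^{i\xi}+be^{-i\xi}$, and $E_1=P_{\mathrm I}(S^1)=\{ae^{i\xi}+be^{-i\xi};\ \xi\in\mathbf{R}\}$ is the ellipse (curve) with focal points $\pm2\sqrt{ab}$ and major semi-axis of length $|a|+|b|$. $P_\delta=P_{\mathrm I}+\delta Q_\omega$, where $Q_\omega=(q_{j,k}(\omega))_{1\le j,k\le N}$ has independent identically distributed entries with the complex Gaussian law $\mathcal{N}_{\mathbf{C}}(0,1)$ (density $\pi^{-1}e^{-|q|^2}$ with respect to Lebesgue measure on $\mathbf{C}$). Eigenvalues are counted with algebraic multiplicity. Constants are independent of $N$ (they may depend on $a,b,\kappa,C_0,\Gamma,\delta_0$). *)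

theory Defs
  imports "HOL-Probability.Probability" "Jordan_Normal_Form.Spectral_Radius"
begin

(* Indices run over 0..<N instead of 1..N; the matrix is Toeplitz, so this shift is immaterial. *)
definition bidiag_toeplitz :: "nat \<Rightarrow> complex \<Rightarrow> complex \<Rightarrow> complex mat" where
  "bidiag_toeplitz N a b =
     mat N N (\<lambda>(j, k). if k = j + 1 then a else if j = k + 1 then b else 0)"

definition toeplitz_symbol :: "complex \<Rightarrow> complex \<Rightarrow> real \<Rightarrow> complex" where
  "toeplitz_symbol a b \<xi> =
     a * exp (\<i> * complex_of_real \<xi>) + b * exp (- (\<i> * complex_of_real \<xi>))"

definition symbol_ellipse :: "complex \<Rightarrow> complex \<Rightarrow> complex set" where
  "symbol_ellipse a b = range (toeplitz_symbol a b)"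

(* An N x N random matrix on M with independent entries, each having density
   exp(-|q|^2)/pi with respect to Lebesgue measure on the complex plane. *)
definition iid_complex_gaussian_matrix ::
    "'w measure \<Rightarrow> nat \<Rightarrow> ('w \<Rightarrow> complex mat) \<Rightarrow> bool" where
  "iid_complex_gaussian_matrix M N Q \<longleftrightarrow>
     prob_space M \<and>
     (\<forall>\<omega>\<in>space M. Q \<omega> \<in> carrier_mat N N) \<and>
     prob_space.indep_vars M (\<lambda>_. borel) (\<lambda>jk \<omega>. Q \<omega> $$ jk) ({..<N} \<times> {..<N}) \<and>
     (\<forall>jk\<in>{..<N} \<times> {..<N}.
        distributed M lborel (\<lambda>\<omega>. Q \<omega> $$ jk) (\<lambda>q. ennreal (exp (- (norm q)\<^sup>2) / pi)))"

definition eigenvalue_count :: "complex mat \<Rightarrow> complex set \<Rightarrow> nat" where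
  "eigenvalue_count A S = (\<Sum>z\<in>spectrum A \<inter> S. Polynomial.order z (char_poly A))"

(* "With probability at least p, P holds".  The event {\<omega>. P \<omega>} need not be measurable
   (the neighborhood in the theorem is an arbitrary set), so P is required to hold on some
   measurable event of probability at least p.  For measurable {\<omega>. P \<omega>} this is the same as
   prob {\<omega>. P \<omega>} \<ge> p. *)
definition holds_with_prob_ge :: "'w measure \<Rightarrow> real \<Rightarrow> ('w \<Rightarrow> bool) \<Rightarrow> bool" where
  "holds_with_prob_ge M p P \<longleftrightarrow>
     (\<exists>A\<in>sets M. (\<forall>\<omega>\<in>A. P \<omega>) \<and> measure M A \<ge> p)"

end

(* The map l(w) = a w + b cnj w sends the unit circle to the ellipse and the unit disc to its
   interior.  The numerical range of the unperturbed matrix lies in the filled ellipse, so with high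
   probability all eigenvalues outside the neighborhood lie in a compact subset of the open filled
   ellipse, which is covered by finitely many discs; it remains to count zeros of det(P_delta - z)
   in a disc by a Jensen-type estimate.

   For z inside the ellipse both roots of a u^2 - z u + b lie in the open unit disc.  Hence the lower
   triangular Toeplitz matrices with entries a, -z, b, which are P_I - z up to a shift of the columns,
   have inverses bounded on l^1 uniformly in the dimension, and |det(P_delta - z)| is at most
   C |a|^N on the discs.  At a centre of a disc the determinant is an affine function of the
   Gaussian entry in the bottom left corner, whose slope delta * minor has modulus at least
   c delta |a|^N; so it falls below |a|^N exp(-N^delta_0) only with probability
   O(N^(2 kappa) exp(-2 N^delta_0)). *)
theory Submission
  imports Defs "HOL-Complex_Analysis.Conformal_Mappings"
begin

unbundle no vec_syntax

section \<open>Perturbation of determinants in the \<open>\<ell>\<^sup>1\<close> norm\<close>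

text \<open>At a fixed z inside the ellipse the unperturbed determinant is exponentially smaller
  than |a|^N: it is, up to sign, a^N times the complete homogeneous polynomial of degree N in the
  two roots. A lower bound at a disc centre must therefore come from the noise, and the corner entry
  is suitable because its cofactor has modulus |a|^(N-1) before the perturbation. The l^1 norm is
  used because a determinant is bounded by the product of its column sums. Noise with entries at
  most e changes a determinant by a factor at most (1 + N e / c)^N, up to one constant factor, and
  this stays bounded as long as N^2 e does. With Gaussian entries truncated at 2 N^(delta_0/2), e is
  of order N^(delta_0/2 - kappa), so kappa > 5/2 and delta_0 < 1 suffice; the truncation fails only
  with probability O(N^2 exp(-2 N^delta_0)). For delta_0 >= 1 the claimed count is at least the
  dimension. Between the upper bound C |a|^N and the threshold |a|^N exp(-N^delta_0) there is room
  for only O(N^delta_0) zeros.\<close>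

definition norm1 :: "complex vec \<Rightarrow> real" where
  "norm1 v = (\<Sum>i<dim_vec v. cmod (v $ i))"

lemma norm1_nonneg: "0 \<le> norm1 v"
  unfolding norm1_def by (intro sum_nonneg) auto

lemma norm1_eq_0_iff:
  assumes "v \<in> carrier_vec n"
  shows "norm1 v = 0 \<longleftrightarrow> v = 0\<^sub>v n"
proof -
  have "norm1 v = 0 \<longleftrightarrow> (\<forall>i<n. v $ i = 0)"
    using assms unfolding norm1_def by (subst sum_nonneg_eq_0_iff) auto
  thus ?thesis using assms by (auto simp: vec_eq_iff)
qed

lemma norm1_triangle:
  assumes "v \<in> carrier_vec n" "w \<in> carrier_vec n"
  shows "norm1 (v + w) \<le> norm1 v + norm1 w"
proof -
  have "norm1 (v + w) = (\<Sum>i<n. cmod (v $ i + w $ i))"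
    using assms unfolding norm1_def by (intro sum.cong) auto
  also have "\<dots> \<le> (\<Sum>i<n. cmod (v $ i) + cmod (w $ i))"
    by (intro sum_mono norm_triangle_ineq)
  finally show ?thesis using assms unfolding norm1_def by (simp add: sum.distrib)
qed

text \<open>In the Leibniz formula the permutations form a subset of all maps of the index set into
  itself, and the sum over all maps factors into column sums.\<close>

lemma cmod_det_le_prod_col_sums:
  fixes A :: "complex mat"
  assumes A: "A \<in> carrier_mat n n"
  shows "cmod (Determinant.det A) \<le> (\<Prod>j<n. norm1 (Matrix.col A j))"
proof -
  let ?P = "{p. p permutes {0..<n}}"
  have sgn: "\<bar>real_of_int (sign p)\<bar> = 1" for p :: "nat \<Rightarrow> nat"
    by (simp add: sign_def)
  have "cmod (Determinant.det A) \<le> (\<Sum>p\<in>?P. cmod (signof p * (\<Prod>j<n. A $$ (p j, j))))"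
    unfolding det_col[OF A] by (rule norm_sum)
  also have "\<dots> = (\<Sum>p\<in>?P. \<Prod>j<n. cmod (A $$ (p j, j)))"
    by (simp add: norm_mult sgn prod_norm)
  \<comment> \<open>Restriction makes each permutation extensional, so that the index set becomes a
    subset of the \<open>PiE\<close> below.\<close>
  also have "\<dots> = (\<Sum>f\<in>(\<lambda>p. restrict p {..<n}) ` ?P. \<Prod>j<n. cmod (A $$ (f j, j)))"
  proof (subst sum.reindex)
    show "inj_on (\<lambda>p. restrict p {..<n}) ?P"
    proof (rule inj_onI)
      fix p q assume "p \<in> ?P" "q \<in> ?P" and eq: "restrict p {..<n} = restrict q {..<n}"
      show "p = q"
      proof
        fix x show "p x = q x"
        proof (cases "x < n")
          case True thus ?thesis using fun_cong[OF eq, of x] by simp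
        next
          case False thus ?thesis
            using \<open>p \<in> ?P\<close> \<open>q \<in> ?P\<close> by (auto simp: permutes_def)
        qed
      qed
    qed
  qed simp
  also have "\<dots> \<le> (\<Sum>f\<in>PiE {..<n} (\<lambda>_. {..<n}). \<Prod>j<n. cmod (A $$ (f j, j)))"
    by (rule sum_mono2)
       (auto intro!: finite_PiE prod_nonneg dest: permutes_in_image)
  also have "\<dots> = (\<Prod>j<n. \<Sum>i<n. cmod (A $$ (i, j)))"
    by (simp add: prod_sum_PiE)
  also have "\<dots> = (\<Prod>j<n. norm1 (Matrix.col A j))"
    using A by (intro prod.cong refl) (auto simp: norm1_def)
  finally show ?thesis .
qed

text \<open>Apply the column bound to \<open>A\<^sup>-\<^sup>1 B\<close>, whose \<open>j\<close>-th column is \<open>e\<^sub>j\<close> plus the image of a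
  column of \<open>B - A\<close> under \<open>A\<^sup>-\<^sup>1\<close>.\<close>

lemma cmod_det_le_perturbation:
  fixes A B :: "complex mat"
  assumes A: "A \<in> carrier_mat n n" and B: "B \<in> carrier_mat n n" and c: "c > 0"
    and lower: "\<And>x. x \<in> carrier_vec n \<Longrightarrow> c * norm1 x \<le> norm1 (A *\<^sub>v x)"
  shows "cmod (Determinant.det B) \<le>
    cmod (Determinant.det A) * (\<Prod>j<n. 1 + norm1 (Matrix.col (B - A) j) / c)"
proof -
  \<comment> \<open>A kernel vector would violate the lower bound; the inverse \<open>S\<close>
    below therefore exists.\<close>
  have "Determinant.det A \<noteq> 0"
  proof
    assume "Determinant.det A = 0"
    then obtain v where v: "v \<in> carrier_vec n" "v \<noteq> 0\<^sub>v n" "A *\<^sub>v v = 0\<^sub>v n"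
      using det_0_iff_vec_prod_zero[OF A] by blast
    have "c * norm1 v \<le> norm1 (0\<^sub>v n)" using lower[OF v(1)] v(3) by simp
    hence "norm1 v \<le> 0" using c by (simp add: norm1_def mult_le_0_iff)
    hence "norm1 v = 0" using norm1_nonneg[of v] by simp
    thus False using v norm1_eq_0_iff by blast
  qed
  from det_non_zero_imp_unit[OF A this, unfolded Units_def, of "()"]
  obtain S where S: "S \<in> carrier_mat n n" "S * A = 1\<^sub>m n" "A * S = 1\<^sub>m n"
    by (auto simp: ring_mat_def)
  define D where "D = B - A"
  have D: "D \<in> carrier_mat n n" unfolding D_def using A B by (intro minus_carrier_mat)
  have SB: "S * B = 1\<^sub>m n + S * D"
  proof -
    have "B = A + D" unfolding D_def using A B by auto
    thus ?thesis using mult_add_distrib_mat[OF S(1) A D] S(2) by simp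
  qed
  have col: "norm1 (Matrix.col (S * B) j) \<le> 1 + norm1 (Matrix.col D j) / c" if j: "j < n" for j
  proof -
    define d where "d = Matrix.col D j"
    have d: "d \<in> carrier_vec n" unfolding d_def using D by auto
    have "Matrix.col (S * B) j = unit_vec n j + S *\<^sub>v d"
      unfolding SB d_def using S D j by (auto simp: col_mult2 intro!: eq_vecI)
    moreover have "norm1 (unit_vec n j + S *\<^sub>v d) \<le> norm1 (unit_vec n j) + norm1 (S *\<^sub>v d)"
      by (rule norm1_triangle[of _ n]) (use S d in auto)
    moreover have "norm1 (unit_vec n j) = 1"
    proof -
      have "norm1 (unit_vec n j) = (\<Sum>i<n. if i = j then 1 else 0)"
        unfolding norm1_def by (intro sum.cong) (auto simp: unit_vec_def)
      thus ?thesis using j by simp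
    qed
    moreover have "A *\<^sub>v (S *\<^sub>v d) = d"
      using assoc_mult_mat_vec[OF A S(1) d] S(3) d by simp
    hence "c * norm1 (S *\<^sub>v d) \<le> norm1 d" using lower[of "S *\<^sub>v d"] S d by auto
    hence "norm1 (S *\<^sub>v d) \<le> norm1 d / c" using c by (simp add: field_simps)
    ultimately show ?thesis unfolding d_def by simp
  qed
  have "Determinant.det B = Determinant.det (A * (S * B))"
    using assoc_mult_mat[OF A S(1) B] S(3) B by simp
  also have "\<dots> = Determinant.det A * Determinant.det (S * B)"
    using det_mult[OF A] S B by auto
  finally have "cmod (Determinant.det B) = cmod (Determinant.det A) * cmod (Determinant.det (S * B))"
    by (simp add: norm_mult)
  also have "cmod (Determinant.det (S * B)) \<le> (\<Prod>j<n. norm1 (Matrix.col (S * B) j))"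
    using cmod_det_le_prod_col_sums[of "S * B" n] S B by auto
  also have "\<dots> \<le> (\<Prod>j<n. 1 + norm1 (Matrix.col D j) / c)"
    by (rule prod_mono) (auto simp: norm1_nonneg col)
  finally show ?thesis unfolding D_def by (simp add: mult_left_mono)
qed

section \<open>The shift on l^1 and lower triangular Toeplitz matrices\<close>

lemma sum_shift_le:
  fixes f :: "nat \<Rightarrow> real"
  assumes "\<And>i. 0 \<le> f i"
  shows "(\<Sum>i<n. if i = 0 then 0 else f (i - 1)) \<le> (\<Sum>i<n. f i)"
proof (cases n)
  case (Suc m)
  have "(\<Sum>i<n. if i = 0 then 0 else f (i - 1)) = (\<Sum>i<m. f i)"
    unfolding Suc by (subst sum.lessThan_Suc_shift) simp
  also have "\<dots> \<le> (\<Sum>i<n. f i)" unfolding Suc using assms by simp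
  finally show ?thesis .
qed simp

text \<open>The shift with zero fill does not increase the l^1 norm, so the termwise reverse
  triangle inequality leaves the factor 1 - |w|. This bounds a bidiagonal factor 1 - w J from
  below.\<close>

lemma sum_norm_sub_shift_ge:
  fixes y :: "nat \<Rightarrow> complex"
  shows "(1 - cmod w) * (\<Sum>i<n. cmod (y i))
    \<le> (\<Sum>i<n. cmod (y i - w * (if i = 0 then 0 else y (i - 1))))"
proof -
  have "(\<Sum>i<n. cmod (y i)) - cmod w * (\<Sum>i<n. if i = 0 then 0 else cmod (y (i - 1)))
      \<le> (\<Sum>i<n. cmod (y i - w * (if i = 0 then 0 else y (i - 1))))"
    unfolding sum_distrib_left sum_subtractf[symmetric]
  proof (rule sum_mono)
    fix i
    show "cmod (y i) - cmod w * (if i = 0 then 0 else cmod (y (i - 1)))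
      \<le> cmod (y i - w * (if i = 0 then 0 else y (i - 1)))"
      using norm_triangle_ineq2[of "y i" "w * (if i = 0 then 0 else y (i - 1))"]
      by (auto simp: norm_mult)
  qed
  moreover have "cmod w * (\<Sum>i<n. if i = 0 then 0 else cmod (y (i - 1))) \<le> cmod w * (\<Sum>i<n. cmod (y i))"
    by (intro mult_left_mono sum_shift_le) auto
  ultimately show ?thesis by (simp add: algebra_simps)
qed

text \<open>In terms of the nilpotent shift J this is a - z J + b J^2. The dimension is free because
  size N + 1 serves the upper bound on determinants and size N - 1 the minor of the corner
  entry.\<close>

definition lower_toeplitz :: "nat \<Rightarrow> complex \<Rightarrow> complex \<Rightarrow> complex \<Rightarrow> complex mat" where
  "lower_toeplitz n a b z =
     mat n n (\<lambda>(i, j). if i = j then a else if i = j + 1 then - z else if i = j + 2 then b else 0)"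

lemma lower_toeplitz_carrier [simp]: "lower_toeplitz n a b z \<in> carrier_mat n n"
  unfolding lower_toeplitz_def by simp

lemma det_lower_toeplitz: "Determinant.det (lower_toeplitz n a b z) = a ^ n"
proof -
  have "Determinant.det (lower_toeplitz n a b z) = prod_list (diag_mat (lower_toeplitz n a b z))"
    by (rule det_lower_triangular[of n]) (auto simp: lower_toeplitz_def)
  also have "diag_mat (lower_toeplitz n a b z) = replicate n a"
    by (auto simp: diag_mat_def lower_toeplitz_def intro!: nth_equalityI)
  finally show ?thesis by simp
qed

lemma lower_toeplitz_mult_vec:
  assumes x: "x \<in> carrier_vec n" and i: "i < n"
  shows "(lower_toeplitz n a b z *\<^sub>v x) $ i =
    a * x $ i - z * (if i = 0 then 0 else x $ (i - 1)) + b * (if i < 2 then 0 else x $ (i - 2))"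
proof -
  have "(lower_toeplitz n a b z *\<^sub>v x) $ i = (\<Sum>j<n. (if i = j then a else if i = j + 1 then - z else if i = j + 2 then b else 0) * x $ j)"
    using x i by (auto simp: lower_toeplitz_def scalar_prod_def atLeast0LessThan intro!: sum.cong)
  also have "\<dots> = (\<Sum>j<n. (if j = i then a * x $ i else 0) - (if i \<noteq> 0 \<and> j = i - 1 then z * x $ (i - 1) else 0)
     + (if 2 \<le> i \<and> j = i - 2 then b * x $ (i - 2) else 0))"
    by (intro sum.cong) (auto)
  also have "\<dots> = a * x $ i - z * (if i = 0 then 0 else x $ (i - 1)) + b * (if i < 2 then 0 else x $ (i - 2))"
    using i by (cases "i = 0"; cases "i < 2") (auto simp: sum.distrib sum_subtractf)
  finally show ?thesis .
qed

text \<open>If \<open>w\<^sub>1, w\<^sub>2\<close> are the roots of \<open>a u\<^sup>2 - z u + b\<close>, the matrix factors as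
  \<open>a (1 - w\<^sub>1 J) (1 - w\<^sub>2 J)\<close> with the nilpotent shift \<open>J\<close>, a contraction in the \<open>\<ell>\<^sup>1\<close> norm.\<close>

lemma lower_toeplitz_norm1_ge_roots:
  assumes x: "x \<in> carrier_vec n" and z: "z = a * (w1 + w2)" and b: "b = a * (w1 * w2)"
    and w1: "cmod w1 \<le> 1"
  shows "cmod a * (1 - cmod w1) * (1 - cmod w2) * norm1 x \<le> norm1 (lower_toeplitz n a b z *\<^sub>v x)"
proof -
  define y where "y i = x $ i - w2 * (if i = 0 then 0 else x $ (i - 1))" for i
  have eq: "(lower_toeplitz n a b z *\<^sub>v x) $ i = a * (y i - w1 * (if i = 0 then 0 else y (i - 1)))"
    if "i < n" for i
    unfolding lower_toeplitz_mult_vec[OF x that] y_def z b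
    by (cases i) (auto simp: algebra_simps numeral_2_eq_2)
  have "norm1 (lower_toeplitz n a b z *\<^sub>v x)
      = (\<Sum>i<n. cmod ((lower_toeplitz n a b z *\<^sub>v x) $ i))"
    unfolding norm1_def using x by (simp add: lower_toeplitz_def)
  also have "\<dots> = cmod a * (\<Sum>i<n. cmod (y i - w1 * (if i = 0 then 0 else y (i - 1))))"
    by (simp add: eq norm_mult sum_distrib_left)
  finally have norm_eq: "norm1 (lower_toeplitz n a b z *\<^sub>v x) = \<dots>" .
  have "(1 - cmod w2) * norm1 x \<le> (\<Sum>i<n. cmod (y i))"
    using sum_norm_sub_shift_ge[of w2 "\<lambda>i. x $ i" n] x unfolding y_def norm1_def by simp
  hence "(1 - cmod w1) * ((1 - cmod w2) * norm1 x) \<le> (1 - cmod w1) * (\<Sum>i<n. cmod (y i))"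
    using w1 by (intro mult_left_mono) auto
  also have "\<dots> \<le> (\<Sum>i<n. cmod (y i - w1 * (if i = 0 then 0 else y (i - 1))))"
    by (rule sum_norm_sub_shift_ge)
  finally show ?thesis unfolding norm_eq by (simp add: mult.assoc mult_left_mono)
qed

text \<open>Only the first subdiagonal depends on \<open>z\<close>, and J has l^1 norm at most 1.
  This carries a lower bound at one point over to a disc around it.\<close>

lemma lower_toeplitz_norm1_diff:
  assumes x: "x \<in> carrier_vec n"
  shows "norm1 (lower_toeplitz n a b z *\<^sub>v x)
    \<le> norm1 (lower_toeplitz n a b z' *\<^sub>v x) + cmod (z - z') * norm1 x"
proof -
  have "norm1 (lower_toeplitz n a b z *\<^sub>v x)
      = (\<Sum>i<n. cmod ((lower_toeplitz n a b z *\<^sub>v x) $ i))"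
    unfolding norm1_def by (simp add: lower_toeplitz_def)
  also have "\<dots> \<le> (\<Sum>i<n. cmod ((lower_toeplitz n a b z' *\<^sub>v x) $ i)
      + cmod (z - z') * (if i = 0 then 0 else cmod (x $ (i - 1))))"
  proof (rule sum_mono)
    fix i assume "i \<in> {..<n}" hence i: "i < n" by simp
    have "(lower_toeplitz n a b z *\<^sub>v x) $ i = (lower_toeplitz n a b z' *\<^sub>v x) $ i
        - (z - z') * (if i = 0 then 0 else x $ (i - 1))"
      by (simp add: lower_toeplitz_mult_vec[OF x i] algebra_simps)
    also have "cmod \<dots> \<le> cmod ((lower_toeplitz n a b z' *\<^sub>v x) $ i)
      + cmod ((z - z') * (if i = 0 then 0 else x $ (i - 1)))" by (rule norm_triangle_ineq4)
    finally show "cmod ((lower_toeplitz n a b z *\<^sub>v x) $ i) \<le> cmod ((lower_toeplitz n a b z' *\<^sub>v x) $ i)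
      + cmod (z - z') * (if i = 0 then 0 else cmod (x $ (i - 1)))"
      by (auto simp: norm_mult split: if_splits)
  qed
  also have "\<dots> = norm1 (lower_toeplitz n a b z' *\<^sub>v x)
      + cmod (z - z') * (\<Sum>i<n. if i = 0 then 0 else cmod (x $ (i - 1)))"
    unfolding norm1_def by (simp add: sum.distrib sum_distrib_left lower_toeplitz_def)
  also have "(\<Sum>i<n. if i = 0 then 0 else cmod (x $ (i - 1))) \<le> norm1 x"
    using sum_shift_le[of "\<lambda>i. cmod (x $ i)" n] x unfolding norm1_def by simp
  finally show ?thesis by (simp add: mult_left_mono)
qed

text \<open>The equation reads a u (u - w) = b (cnj w u - 1). If |u| >= 1, the Blaschke inequality
  |cnj w u - 1| <= |u - w| gives |a| |u| <= |b|, contradicting |b| < |a|.\<close>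

lemma quadratic_root_inside:
  fixes a b u w :: complex
  assumes ab: "cmod b < cmod a" and w: "cmod w < 1"
    and root: "a * u\<^sup>2 - (a * w + b * cnj w) * u + b = 0"
  shows "cmod u < 1"
proof (rule ccontr)
  assume "\<not> cmod u < 1" hence u: "1 \<le> cmod u" by simp
  have "a * u * (u - w) = b * (cnj w * u - 1)"
    using root by (simp add: algebra_simps power2_eq_square)
  hence "cmod a * cmod u * cmod (u - w) = cmod b * cmod (cnj w * u - 1)"
    by (metis norm_mult)
  moreover have "cmod (cnj w * u - 1) \<le> cmod (u - w)"
  proof (rule power2_le_imp_le)
    have "0 \<le> ((cmod u)\<^sup>2 - 1) * (1 - (cmod w)\<^sup>2)"
      using u w by (intro mult_nonneg_nonneg) (auto simp: power_le_one_iff abs_square_le_1 one_le_power)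
    also have "\<dots> = (cmod (u - w))\<^sup>2 - (cmod (cnj w * u - 1))\<^sup>2"
      unfolding cmod_power2 by (simp add: algebra_simps power2_eq_square)
    finally show "(cmod (cnj w * u - 1))\<^sup>2 \<le> (cmod (u - w))\<^sup>2" by simp
  qed simp
  ultimately have "cmod a * cmod u * cmod (u - w) \<le> cmod b * cmod (u - w)"
    by (metis mult_left_mono norm_ge_zero)
  moreover have "cmod (u - w) > 0" using u w by auto
  ultimately have "cmod a * cmod u \<le> cmod b" by simp
  moreover have "cmod a * 1 \<le> cmod a * cmod u" using u by (intro mult_left_mono) auto
  ultimately show False using ab by simp
qed

text \<open>A single \<open>c\<close>, independent of the dimension, serves both as radius of the
  disc and as lower bound: the constant \<open>k\<close> at the centre comes from the two roots,
  half of it pays for moving \<open>z\<close>, and the other half remains.\<close>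

lemma lower_toeplitz_norm1_ge:
  fixes a b w :: complex
  assumes ab: "cmod b < cmod a" and w: "cmod w < 1"
  shows "\<exists>c>0. \<forall>n z. \<forall>x\<in>carrier_vec n. cmod (z - (a * w + b * cnj w)) \<le> c \<longrightarrow>
    c * norm1 x \<le> norm1 (lower_toeplitz n a b z *\<^sub>v x)"
proof -
  have a: "a \<noteq> 0" using ab by auto
  define z0 where "z0 = a * w + b * cnj w"
  define s where "s = csqrt (z0\<^sup>2 - 4 * a * b)"
  define u1 u2 where "u1 = (z0 + s) / (2 * a)" and "u2 = (z0 - s) / (2 * a)"
  have s2: "s\<^sup>2 = z0\<^sup>2 - 4 * a * b" unfolding s_def by simp
  have sum: "z0 = a * (u1 + u2)" unfolding u1_def u2_def using a by (simp add: field_simps)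
  have "u1 * u2 = (z0\<^sup>2 - s\<^sup>2) / (4 * a\<^sup>2)"
    unfolding u1_def u2_def by (simp add: power2_eq_square algebra_simps)
  hence prod: "b = a * (u1 * u2)" unfolding s2 using a by (simp add: power2_eq_square)
  have "cmod u1 < 1"
    by (rule quadratic_root_inside[OF ab w], fold z0_def, subst sum, subst prod)
       (simp add: algebra_simps power2_eq_square)
  moreover have "cmod u2 < 1"
    by (rule quadratic_root_inside[OF ab w], fold z0_def, subst sum, subst prod)
       (simp add: algebra_simps power2_eq_square)
  ultimately have u: "cmod u1 < 1" "cmod u2 < 1" by auto
  define k where "k = cmod a * (1 - cmod u1) * (1 - cmod u2)"
  have k: "k > 0" unfolding k_def using a u by simp
  have "k / 2 * norm1 x \<le> norm1 (lower_toeplitz n a b z *\<^sub>v x)"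
    if x: "x \<in> carrier_vec n" and z: "cmod (z - z0) \<le> k / 2" for n z x
  proof -
    have "k * norm1 x \<le> norm1 (lower_toeplitz n a b z0 *\<^sub>v x)"
      unfolding k_def by (rule lower_toeplitz_norm1_ge_roots[OF x sum prod]) (use u in auto)
    also have "\<dots> \<le> norm1 (lower_toeplitz n a b z *\<^sub>v x) + cmod (z0 - z) * norm1 x"
      by (rule lower_toeplitz_norm1_diff[OF x])
    also have "cmod (z0 - z) * norm1 x \<le> k / 2 * norm1 x"
      using z by (intro mult_right_mono norm1_nonneg) (simp add: norm_minus_commute)
    finally show ?thesis by (simp add: algebra_simps)
  qed
  thus ?thesis using k unfolding z0_def[symmetric] by (intro exI[of _ "k / 2"]) auto
qed

section \<open>Determinants and eigenvalues of perturbed bidiagonal Toeplitz matrices\<close>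

lemma norm1_mult_mat_vec_le:
  assumes E: "E \<in> carrier_mat n n" and x: "x \<in> carrier_vec n"
    and e: "\<And>i j. i < n \<Longrightarrow> j < n \<Longrightarrow> cmod (E $$ (i, j)) \<le> e"
  shows "norm1 (E *\<^sub>v x) \<le> real n * e * norm1 x"
proof -
  have "norm1 (E *\<^sub>v x) = (\<Sum>i<n. cmod (\<Sum>j<n. E $$ (i, j) * x $ j))"
    using E x unfolding norm1_def by (auto simp: scalar_prod_def atLeast0LessThan)
  also have "\<dots> \<le> (\<Sum>i<n. \<Sum>j<n. e * cmod (x $ j))"
    using e by (intro sum_mono order.trans[OF norm_sum]) (auto simp: norm_mult intro!: sum_mono mult_right_mono)
  also have "\<dots> = real n * e * norm1 x"
    using x by (simp add: norm1_def sum_distrib_left mult.assoc)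
  finally show ?thesis .
qed

lemma bidiag_toeplitz_carrier [simp]: "bidiag_toeplitz n a b \<in> carrier_mat n n"
  unfolding bidiag_toeplitz_def by simp

text \<open>Bordering the matrix by a first row and a last column \<open>e\<^sub>0\<close> turns it into a perturbation
  of a lower triangular Toeplitz matrix, up to the last column.\<close>

lemma cmod_det_bidiag_toeplitz_le:
  assumes E: "E \<in> carrier_mat n n" and c: "c > 0"
    and e: "\<And>i j. i < n \<Longrightarrow> j < n \<Longrightarrow> cmod (E $$ (i, j)) \<le> e"
    and lower: "\<And>m x. x \<in> carrier_vec m \<Longrightarrow> c * norm1 x \<le> norm1 (lower_toeplitz m a b z *\<^sub>v x)"
  shows "cmod (Determinant.det (bidiag_toeplitz n a b + E - z \<cdot>\<^sub>m 1\<^sub>m n))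
    \<le> cmod a ^ Suc n * (1 + (1 + cmod a) / c) * (1 + real n * e / c) ^ n"
proof -
  define T where "T = lower_toeplitz (Suc n) a b z"
  define B where "B = mat (Suc n) (Suc n) (\<lambda>(i, j). if j = n then (if i = 0 then 1 else 0)
    else T $$ (i, j) + (if i = 0 then 0 else E $$ (i - 1, j)))"
  have T: "T \<in> carrier_mat (Suc n) (Suc n)" and B: "B \<in> carrier_mat (Suc n) (Suc n)"
    unfolding T_def B_def by simp_all
  \<comment> \<open>Expanding along the last column e_0 leaves just this minor, so \<open>B\<close>
    has the wanted determinant up to sign.\<close>
  have minor: "mat_delete B 0 n = bidiag_toeplitz n a b + E - z \<cdot>\<^sub>m 1\<^sub>m n"
    using E unfolding mat_delete_def B_def T_def lower_toeplitz_def bidiag_toeplitz_def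
    by (intro eq_matI) auto
  have "Determinant.det B = (\<Sum>i<Suc n. B $$ (i, n) * cofactor B i n)"
    by (rule laplace_expansion_column[OF B]) simp
  also have "\<dots> = (\<Sum>i<Suc n. if i = 0 then cofactor B 0 n else 0)"
    by (intro sum.cong) (auto simp: B_def)
  also have "\<dots> = cofactor B 0 n" by (subst sum.delta) auto
  finally have det: "cmod (Determinant.det (bidiag_toeplitz n a b + E - z \<cdot>\<^sub>m 1\<^sub>m n)) = cmod (Determinant.det B)"
    by (simp add: cofactor_def minor norm_mult norm_power)
  have col: "norm1 (Matrix.col (B - T) j) \<le> real n * e" if j: "j < n" for j
  proof -
    have "norm1 (Matrix.col (B - T) j) = (\<Sum>i<Suc n. if i = 0 then 0 else cmod (E $$ (i - 1, j)))"
      using T j unfolding norm1_def by (auto simp: B_def intro!: sum.cong)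
    also have "\<dots> = (\<Sum>i<n. cmod (E $$ (i, j)))" by (subst sum.lessThan_Suc_shift) simp
    also have "\<dots> \<le> real n * e" using sum_bounded_above[of "{..<n}" "\<lambda>i. cmod (E $$ (i, j))" e] e j by simp
    finally show ?thesis .
  qed
  \<comment> \<open>Here e_0 has replaced a e_n. The change is not small, but it is confined to one
    column and costs a single constant factor instead of an N-th power.\<close>
  have last: "norm1 (Matrix.col (B - T) n) \<le> 1 + cmod a"
  proof -
    have "norm1 (Matrix.col (B - T) n) = (\<Sum>i<Suc n. cmod ((if i = 0 then 1 else 0) - (if i = n then a else 0)))"
      using T unfolding norm1_def by (auto simp: B_def T_def lower_toeplitz_def intro!: sum.cong)
    also have "\<dots> \<le> (\<Sum>i<Suc n. (if i = 0 then 1 else 0) + (if i = n then cmod a else 0))"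
      using norm_triangle_ineq4[of 1 a] by (intro sum_mono) auto
    also have "\<dots> = 1 + cmod a" by (subst sum.distrib, subst sum.delta, simp, subst sum.delta) auto
    finally show ?thesis .
  qed
  have "cmod (Determinant.det B) \<le> cmod (Determinant.det T) * (\<Prod>j<Suc n. 1 + norm1 (Matrix.col (B - T) j) / c)"
    by (rule cmod_det_le_perturbation[OF T B c]) (use lower in \<open>auto simp: T_def\<close>)
  also have "\<dots> = cmod a ^ Suc n * ((\<Prod>j<n. 1 + norm1 (Matrix.col (B - T) j) / c) * (1 + norm1 (Matrix.col (B - T) n) / c))"
    unfolding T_def det_lower_toeplitz by (simp add: norm_mult norm_power)
  also have "\<dots> \<le> cmod a ^ Suc n * ((\<Prod>j<n. 1 + real n * e / c) * (1 + (1 + cmod a) / c))"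
    using c col last
    by (intro mult_left_mono mult_mono prod_mono conjI add_left_mono divide_right_mono
        prod_nonneg add_nonneg_nonneg divide_nonneg_nonneg norm1_nonneg ballI) (auto intro: norm1_nonneg order.trans[OF norm1_nonneg])
  finally show ?thesis unfolding det by (simp add: mult_ac)
qed

text \<open>Deleting the last row and the first column of P_I - z leaves exactly
  \<open>lower_toeplitz m a b z\<close>, of determinant a^m. The comparison of determinants is
  applied with the perturbed matrix as the reference, which turns its upper bound into a lower bound
  for the minor; \<open>small\<close> keeps the reference bounded below with constant c / 2.\<close>

lemma cmod_minor_bidiag_toeplitz_ge:
  assumes E: "E \<in> carrier_mat (Suc m) (Suc m)" and c: "c > 0" and e0: "e \<ge> 0"
    and e: "\<And>i j. i < Suc m \<Longrightarrow> j < Suc m \<Longrightarrow> cmod (E $$ (i, j)) \<le> e"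
    and lower: "\<And>m x. x \<in> carrier_vec m \<Longrightarrow> c * norm1 x \<le> norm1 (lower_toeplitz m a b z *\<^sub>v x)"
    and small: "real (Suc m) * e \<le> c / 2"
  shows "cmod a ^ m \<le> cmod (Determinant.det (mat_delete (bidiag_toeplitz (Suc m) a b + E - z \<cdot>\<^sub>m 1\<^sub>m (Suc m)) m 0))
    * (1 + 2 * real (Suc m) * e / c) ^ Suc m"
proof -
  define T where "T = lower_toeplitz m a b z"
  define F where "F = mat m m (\<lambda>(i, j). E $$ (i, Suc j))"
  have T: "T \<in> carrier_mat m m" and F: "F \<in> carrier_mat m m" unfolding T_def F_def by simp_all
  have minor: "mat_delete (bidiag_toeplitz (Suc m) a b + E - z \<cdot>\<^sub>m 1\<^sub>m (Suc m)) m 0 = T + F"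
    using E unfolding mat_delete_def F_def T_def lower_toeplitz_def bidiag_toeplitz_def
    by (intro eq_matI) auto
  have F_le: "cmod (F $$ (i, j)) \<le> e" if "i < m" "j < m" for i j
    using that e[of i "Suc j"] by (simp add: F_def)
  have me: "real m * e \<le> real (Suc m) * e" using e0 by (intro mult_right_mono) auto
  have "c / 2 * norm1 x \<le> norm1 ((T + F) *\<^sub>v x)" if x: "x \<in> carrier_vec m" for x
  proof -
    have Tx: "T *\<^sub>v x = (T + F) *\<^sub>v x + (- 1) \<cdot>\<^sub>v (F *\<^sub>v x)"
      using T F x by (subst add_mult_distrib_mat_vec) (auto intro!: eq_vecI)
    have "c * norm1 x \<le> norm1 (T *\<^sub>v x)" unfolding T_def by (rule lower[OF x])
    also have "\<dots> \<le> norm1 ((T + F) *\<^sub>v x) + norm1 ((- 1) \<cdot>\<^sub>v (F *\<^sub>v x))"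
      unfolding Tx by (rule norm1_triangle[of _ m]) (use T F x in \<open>auto intro!: mult_mat_vec_carrier\<close>)
    also have "norm1 ((- 1) \<cdot>\<^sub>v (F *\<^sub>v x)) = norm1 (F *\<^sub>v x)"
      unfolding norm1_def by simp
    also have "norm1 (F *\<^sub>v x) \<le> real m * e * norm1 x"
      by (rule norm1_mult_mat_vec_le[OF F x F_le])
    also have "\<dots> \<le> c / 2 * norm1 x"
      using small me by (intro mult_right_mono norm1_nonneg) linarith
    finally show ?thesis by (simp add: algebra_simps)
  qed
  hence "cmod (Determinant.det T) \<le> cmod (Determinant.det (T + F)) *
      (\<Prod>j<m. 1 + norm1 (Matrix.col (T - (T + F)) j) / (c / 2))"
    using T F c by (intro cmod_det_le_perturbation) auto
  also have "(\<Prod>j<m. 1 + norm1 (Matrix.col (T - (T + F)) j) / (c / 2))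
      \<le> (\<Prod>j<m. 1 + 2 * real (Suc m) * e / c)"
  proof (rule prod_mono, intro conjI)
    fix j assume "j \<in> {..<m}" hence j: "j < m" by simp
    show "0 \<le> 1 + norm1 (Matrix.col (T - (T + F)) j) / (c / 2)"
      using c norm1_nonneg by (intro add_nonneg_nonneg divide_nonneg_nonneg) auto
    have "norm1 (Matrix.col (T - (T + F)) j) = (\<Sum>i<m. cmod (F $$ (i, j)))"
      using T F j unfolding norm1_def by (auto intro!: sum.cong)
    also have "\<dots> \<le> real m * e"
      using sum_bounded_above[of "{..<m}" "\<lambda>i. cmod (F $$ (i, j))" e] F_le j by simp
    finally have "norm1 (Matrix.col (T - (T + F)) j) \<le> real (Suc m) * e" using me by linarith
    from divide_right_mono[OF this, of "c / 2"]
    show "1 + norm1 (Matrix.col (T - (T + F)) j) / (c / 2) \<le> 1 + 2 * real (Suc m) * e / c"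
      using c by (simp add: mult_ac)
  qed
  also have "(\<Prod>j<m. 1 + 2 * real (Suc m) * e / c) \<le> (1 + 2 * real (Suc m) * e / c) ^ Suc m"
  proof -
    have "1 \<le> 1 + 2 * real (Suc m) * e / c" using e0 c by simp
    from power_increasing[OF le_SucI[OF order.refl] this, of m] show ?thesis by simp
  qed
  finally show ?thesis
    unfolding minor T_def det_lower_toeplitz by (simp add: norm_power mult_left_mono)
qed

section \<open>Location of the eigenvalues by the numerical range\<close>

lemma real_linear_ellipse_solve:
  fixes a b r :: complex
  assumes ab: "cmod b < cmod a"
  shows "\<exists>w. a * w + b * cnj w = r \<and> cmod w \<le> cmod r / (cmod a - cmod b)"
proof -
  define d where "d = (cmod a)\<^sup>2 - (cmod b)\<^sup>2"
  have d: "d = (cmod a - cmod b) * (cmod a + cmod b)" unfolding d_def by (simp add: power2_eq_square algebra_simps)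
  have d0: "d > 0" unfolding d using ab norm_ge_zero[of b] by (intro mult_pos_pos) linarith+
  \<comment> \<open>Cramer's rule for the equation and its conjugate, a linear system in w and cnj w
    with determinant |a|^2 - |b|^2.\<close>
  define w where "w = (cnj a * r - b * cnj r) / of_real d"
  have dc: "complex_of_real d = a * cnj a - b * cnj b"
    unfolding d_def by (simp add: complex_norm_square flip: of_real_power)
  have "a * w + b * cnj w = ((a * cnj a - b * cnj b) * r) / of_real d"
    unfolding w_def by (simp add: field_simps add_divide_distrib diff_divide_distrib)
  hence "a * w + b * cnj w = r" using d0 unfolding dc[symmetric] by simp
  moreover have "cmod w \<le> cmod r / (cmod a - cmod b)"
  proof -
    have "cmod w \<le> (cmod a * cmod r + cmod b * cmod r) / d"
      unfolding w_def norm_divide using d0 norm_triangle_ineq4[of "cnj a * r" "b * cnj r"]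
      by (simp add: norm_mult divide_right_mono)
    also have "\<dots> = cmod r / (cmod a - cmod b)"
    proof -
      have "cmod a + cmod b \<noteq> 0" using ab norm_ge_zero[of b] by linarith
      hence "cmod r * (cmod a + cmod b) / d = cmod r / (cmod a - cmod b)" unfolding d by simp
      thus ?thesis by (simp add: algebra_simps)
    qed
    finally show ?thesis .
  qed
  ultimately show ?thesis by blast
qed

text \<open>The quadratic form of the unperturbed matrix at a unit vector is \<open>a w + b cnj w\<close> with
  \<open>w = \<Sum> cnj v\<^sub>i v\<^sub>i\<^sub>+\<^sub>1\<close>, so the numerical range lies in the filled ellipse.\<close>

lemma eigenvalue_near_filled_ellipse:
  fixes a b :: complex
  assumes ab: "cmod b < cmod a"
    and E: "E \<in> carrier_mat n n"
    and e: "\<And>i j. i < n \<Longrightarrow> j < n \<Longrightarrow> cmod (E $$ (i, j)) \<le> e"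
    and z: "z \<in> spectrum (bidiag_toeplitz n a b + E)"
  shows "\<exists>w. z = a * w + b * cnj w \<and> cmod w \<le> 1 + real n * e / (cmod a - cmod b)"
proof -
  obtain x where x: "x \<in> carrier_vec n" "x \<noteq> 0\<^sub>v n" "(bidiag_toeplitz n a b + E) *\<^sub>v x = z \<cdot>\<^sub>v x"
    using z E unfolding spectrum_def eigenvalue_def eigenvector_def by auto
  define v where "v i = x $ i" for i
  define S where "S = (\<Sum>i<n. (cmod (v i))\<^sup>2)"
  have S0: "S > 0"
  proof -
    obtain i where "i < n" "v i \<noteq> 0" using x(1,2) unfolding v_def by (auto simp: vec_eq_iff)
    thus ?thesis unfolding S_def by (intro sum_pos2[of _ i]) auto
  qed
  define W where "W = (\<Sum>i<n. if Suc i < n then cnj (v i) * v (Suc i) else 0)"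
  define R where "R = (\<Sum>i<n. \<Sum>j<n. E $$ (i, j) * (cnj (v i) * v j))"
  have row: "z * v i = (if Suc i < n then a * v (Suc i) else 0) + (if i = 0 then 0 else b * v (i - 1))
      + (\<Sum>j<n. E $$ (i, j) * v j)" if i: "i < n" for i
  proof -
    have "z * v i = ((bidiag_toeplitz n a b + E) *\<^sub>v x) $ i" unfolding x(3) v_def using i x(1) by simp
    also have "\<dots> = (\<Sum>j<n. (bidiag_toeplitz n a b $$ (i, j) + E $$ (i, j)) * v j)"
      using i E x(1) unfolding v_def
      by (auto simp: scalar_prod_def atLeast0LessThan bidiag_toeplitz_def intro!: sum.cong)
    also have "\<dots> = (\<Sum>j<n. (if j = Suc i then a * v (Suc i) else 0) + (if i \<noteq> 0 \<and> j = i - 1 then b * v (i - 1) else 0)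
        + E $$ (i, j) * v j)"
      using i unfolding bidiag_toeplitz_def by (intro sum.cong) (auto simp: algebra_simps)
    also have "\<dots> = (if Suc i < n then a * v (Suc i) else 0) + (if i = 0 then 0 else b * v (i - 1))
      + (\<Sum>j<n. E $$ (i, j) * v j)"
      using i by (cases "i = 0") (auto simp: sum.distrib)
    finally show ?thesis .
  qed
  \<comment> \<open>Shifting the index by one turns the subdiagonal sum into the conjugate of the
    superdiagonal one.\<close>
  have "(\<Sum>i<n. cnj (v i) * (if i = 0 then 0 else b * v (i - 1))) = b * cnj W"
  proof (cases n)
    case (Suc k)
    have "(\<Sum>i<n. cnj (v i) * (if i = 0 then 0 else b * v (i - 1))) = (\<Sum>i<k. b * (v i * cnj (v (Suc i))))"
      unfolding Suc by (subst sum.lessThan_Suc_shift) (simp add: algebra_simps)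
    also have "\<dots> = b * cnj W" unfolding W_def Suc by (simp add: sum_distrib_left)
    finally show ?thesis .
  qed (simp add: W_def)
  moreover have "(\<Sum>i<n. cnj (v i) * (if Suc i < n then a * v (Suc i) else 0)) = a * W"
    unfolding W_def sum_distrib_left by (intro sum.cong) auto
  moreover have "(\<Sum>i<n. cnj (v i) * (\<Sum>j<n. E $$ (i, j) * v j)) = R"
    unfolding R_def by (simp add: sum_distrib_left mult_ac)
  moreover have "z * of_real S = (\<Sum>i<n. cnj (v i) * (z * v i))"
    unfolding S_def by (simp add: sum_distrib_left mult_ac complex_norm_square flip: of_real_power)
  ultimately have zS: "z * of_real S = a * W + b * cnj W + R"
    by (simp add: row distrib_left sum.distrib)
  \<comment> \<open>With weight 1/2 each, every |v_i|^2 occurs at most twice in the bound for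
    \<open>W\<close>, hence |W| <= S.\<close>
  have amgm: "cmod (p * q) \<le> ((cmod p)\<^sup>2 + (cmod q)\<^sup>2) / 2" for p q
    using sum_squares_bound[of "cmod p" "cmod q"] by (simp add: norm_mult)
  have W: "cmod W \<le> S"
  proof (cases n)
    case (Suc k)
    have "cmod W \<le> (\<Sum>i<k. ((cmod (v i))\<^sup>2 + (cmod (v (Suc i)))\<^sup>2) / 2)"
      unfolding W_def Suc using amgm[of "cnj (v _)"] by (auto intro!: order.trans[OF norm_sum] sum_mono)
    also have "\<dots> = ((\<Sum>i<k. (cmod (v i))\<^sup>2) + (\<Sum>i<k. (cmod (v (Suc i)))\<^sup>2)) / 2"
      by (simp add: sum.distrib flip: sum_divide_distrib)
    also have "\<dots> \<le> S"
    proof -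
      have "(\<Sum>i<k. (cmod (v i))\<^sup>2) \<le> S" unfolding S_def Suc by simp
      moreover have "(\<Sum>i<k. (cmod (v (Suc i)))\<^sup>2) \<le> S" unfolding S_def Suc by (subst sum.lessThan_Suc_shift) simp
      ultimately show ?thesis by simp
    qed
    finally show ?thesis .
  qed (simp add: W_def S_def)
  have R: "cmod R \<le> real n * e * S"
  proof -
    have "cmod R \<le> (\<Sum>i<n. \<Sum>j<n. e * (((cmod (v i))\<^sup>2 + (cmod (v j))\<^sup>2) / 2))"
      unfolding R_def
    proof (intro order.trans[OF norm_sum] sum_mono)
      fix i j assume ij: "i \<in> {..<n}" "j \<in> {..<n}"
      have "cmod (E $$ (i, j) * (cnj (v i) * v j)) = cmod (E $$ (i, j)) * cmod (cnj (v i) * v j)" by (rule norm_mult)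
      also have "\<dots> \<le> e * (((cmod (v i))\<^sup>2 + (cmod (v j))\<^sup>2) / 2)"
        using ij e[of i j] amgm[of "cnj (v i)" "v j"]
        by (intro mult_mono) (auto intro: order.trans[OF norm_ge_zero])
      finally show "cmod (E $$ (i, j) * (cnj (v i) * v j)) \<le> e * (((cmod (v i))\<^sup>2 + (cmod (v j))\<^sup>2) / 2)" .
    qed
    also have "\<dots> = real n * e * S"
      unfolding S_def by (simp add: sum.distrib flip: sum_distrib_left sum_divide_distrib)
    finally show ?thesis .
  qed
  \<comment> \<open>The error R / S is itself written as the image of a small point
    \<open>w1\<close>; by real linearity it only moves the parameter W / S slightly.\<close>
  obtain w1 where w1: "a * w1 + b * cnj w1 = R / of_real S" "cmod w1 \<le> cmod (R / of_real S) / (cmod a - cmod b)"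
    using real_linear_ellipse_solve[OF ab] by blast
  have "z = (a * W + b * cnj W + R) / of_real S" using zS S0 by (simp add: field_simps)
  hence "z = a * (W / of_real S + w1) + b * cnj (W / of_real S + w1)"
    using w1(1) by (simp add: add_divide_distrib algebra_simps)
  moreover have "cmod (W / of_real S + w1) \<le> 1 + real n * e / (cmod a - cmod b)"
  proof -
    have "cmod (W / of_real S) \<le> 1" using W S0 by (simp add: norm_divide)
    moreover have "cmod (R / of_real S) \<le> real n * e" using R S0 by (simp add: norm_divide field_simps)
    hence "cmod w1 \<le> real n * e / (cmod a - cmod b)"
      using w1(2) ab by (meson divide_right_mono diff_ge_0_iff_ge less_imp_le order.trans)
    ultimately show ?thesis using norm_triangle_ineq[of "W / of_real S" w1] by linarith
  qed
  ultimately show ?thesis by blast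
qed

section \<open>Counting zeros of characteristic polynomials\<close>

text \<open>Roots w in the smaller disc are divided out one at a time. Since |z - w| >= 2r/3 on the
  circle, the maximum principle bounds the quotient by M / (2r/3) on the whole disc, while the value
  at the centre is divided by |z0 - w| <= r/3 only; each root thus accounts for a factor 2.\<close>

lemma proots_count_cball_le:
  fixes p :: "complex poly"
  assumes r: "r > 0" and p0: "poly p z0 \<noteq> 0"
    and M: "\<And>z. z \<in> cball z0 r \<Longrightarrow> cmod (poly p z) \<le> M"
  shows "2 ^ size (filter_mset (\<lambda>z. z \<in> cball z0 (r / 3)) (proots p)) * cmod (poly p z0) \<le> M"
  using p0 M
proof (induction "degree p" arbitrary: p M rule: less_induct)
  case less
  have p: "p \<noteq> 0" using less.prems by auto
  show ?case
  proof (cases "\<exists>w\<in>cball z0 (r / 3). poly p w = 0")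
    case False
    hence "filter_mset (\<lambda>z. z \<in> cball z0 (r / 3)) (proots p) = {#}"
      using p by (subst filter_mset_False[symmetric], intro filter_mset_cong) auto
    thus ?thesis using less.prems(2)[of z0] r by (simp only:) simp
  next
    case True
    then obtain w where w: "w \<in> cball z0 (r / 3)" "poly p w = 0" by blast
    then obtain q where q: "p = [:-w, 1:] * q" by (meson poly_eq_0_iff_dvd dvdE)
    have q0: "q \<noteq> 0" using p q by auto
    have qz0: "poly q z0 \<noteq> 0" using less.prems(1) q by auto
    have deg: "degree q < degree p" unfolding q using q0 by (subst degree_mult_eq) auto
    have bound: "cmod (poly q z) \<le> M / (2 * r / 3)" if "z \<in> cball z0 r" for z
    proof (rule maximum_modulus_frontier[of "poly q" "cball z0 r"])
      fix z assume "z \<in> frontier (cball z0 r)"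
      hence z: "dist z0 z = r" using r by simp
      have "r \<le> dist z0 w + dist w z" using dist_triangle[of z0 z w] z by simp
      hence "2 * r / 3 \<le> cmod (z - w)" using w(1) by (simp add: dist_norm norm_minus_commute)
      hence "2 * r / 3 * cmod (poly q z) \<le> cmod (z - w) * cmod (poly q z)"
        by (intro mult_right_mono) auto
      also have "\<dots> = cmod (poly p z)" unfolding q by (simp add: norm_mult[symmetric] algebra_simps)
      also have "\<dots> \<le> M" using less.prems(2)[of z] z by simp
      finally show "cmod (poly q z) \<le> M / (2 * r / 3)" using r by (simp add: field_simps)
    qed (use that in \<open>auto intro!: continuous_intros holomorphic_intros\<close>)
    have "proots p = add_mset w (proots q)"
      unfolding q using q0 by (subst proots_mult) auto
    hence "2 ^ size (filter_mset (\<lambda>z. z \<in> cball z0 (r / 3)) (proots p)) * cmod (poly p z0)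
        = 2 * cmod (z0 - w) * (2 ^ size (filter_mset (\<lambda>z. z \<in> cball z0 (r / 3)) (proots q)) * cmod (poly q z0))"
      using w(1) unfolding q by (simp add: norm_mult[symmetric] algebra_simps)
    also have "\<dots> \<le> 2 * (r / 3) * (M / (2 * r / 3))"
      using w(1) r less.hyps[OF deg qz0 bound]
      by (intro mult_mono) (auto simp: dist_norm)
    also have "\<dots> = M" using r by simp
    finally show ?thesis .
  qed
qed

section \<open>Eigenvalues as roots of the characteristic polynomial\<close>

lemma eigenvalue_count_eq:
  assumes A: "A \<in> carrier_mat n n"
  shows "eigenvalue_count A S = size (filter_mset (\<lambda>z. z \<in> S) (proots (char_poly A)))"
proof -
  have "char_poly A \<noteq> 0" using degree_monic_char_poly[OF A] by auto
  moreover from this have "set_mset (filter_mset (\<lambda>z. z \<in> S) (proots (char_poly A))) = spectrum A \<inter> S"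
    using eigenvalue_root_char_poly[OF A] by (auto simp: spectrum_def)
  ultimately show ?thesis unfolding eigenvalue_count_def size_multiset_overloaded_eq
    by (auto intro!: sum.cong)
qed

lemma eigenvalue_count_le_dim:
  assumes A: "A \<in> carrier_mat n n"
  shows "eigenvalue_count A S \<le> n"
proof -
  have "eigenvalue_count A S \<le> size (proots (char_poly A))"
    unfolding eigenvalue_count_eq[OF A] by (rule size_mset_mono) simp
  also have "\<dots> \<le> n" using size_proots_le[of "char_poly A"] degree_monic_char_poly[OF A] by simp
  finally show ?thesis .
qed

lemma eigenvalue_count_le_cover:
  assumes A: "A \<in> carrier_mat n n" and I: "finite I"
    and cover: "spectrum A \<inter> S \<subseteq> (\<Union>i\<in>I. B i)"
  shows "eigenvalue_count A S \<le> (\<Sum>i\<in>I. eigenvalue_count A (B i))"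
proof -
  have fin: "finite (spectrum A)" by (rule card_finite_spectrum(1)[OF A])
  have "eigenvalue_count A S = (\<Sum>z\<in>spectrum A. if z \<in> S then Polynomial.order z (char_poly A) else 0)"
    unfolding eigenvalue_count_def using fin by (simp add: sum.inter_restrict)
  also have "\<dots> \<le> (\<Sum>z\<in>spectrum A. \<Sum>i\<in>I. if z \<in> B i then Polynomial.order z (char_poly A) else 0)"
  proof (rule sum_mono)
    fix z assume z: "z \<in> spectrum A"
    show "(if z \<in> S then Polynomial.order z (char_poly A) else 0)
      \<le> (\<Sum>i\<in>I. if z \<in> B i then Polynomial.order z (char_poly A) else 0)"
    proof (cases "z \<in> S")
      case True
      with z cover obtain i where "i \<in> I" "z \<in> B i" by blast
      with True show ?thesis
        using member_le_sum[of i I "\<lambda>i. if z \<in> B i then Polynomial.order z (char_poly A) else 0"] I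
        by simp
    qed simp
  qed
  also have "\<dots> = (\<Sum>i\<in>I. eigenvalue_count A (B i))"
    unfolding eigenvalue_count_def using fin by (subst sum.swap) (simp add: sum.inter_restrict)
  finally show ?thesis .
qed

lemma cmod_poly_char_poly:
  assumes A: "(A :: complex mat) \<in> carrier_mat n n"
  shows "cmod (poly (char_poly A) z) = cmod (Determinant.det (A - z \<cdot>\<^sub>m 1\<^sub>m n))"
proof -
  have "- char_matrix A z = (- 1) \<cdot>\<^sub>m (A - z \<cdot>\<^sub>m 1\<^sub>m n)"
    using A by (auto simp: char_matrix_def intro!: eq_matI)
  hence "poly (char_poly A) z = Determinant.det ((- 1) \<cdot>\<^sub>m (A - z \<cdot>\<^sub>m 1\<^sub>m n))"
    by (simp add: char_poly_matrix[OF A])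
  also have "Determinant.det ((- 1) \<cdot>\<^sub>m (A - z \<cdot>\<^sub>m 1\<^sub>m n)) = (-1) ^ n * Determinant.det (A - z \<cdot>\<^sub>m 1\<^sub>m n)" using A by simp
  finally show ?thesis by (simp add: norm_mult norm_power)
qed

lemma eigenvalue_count_cball_le:
  assumes A: "A \<in> carrier_mat n n" and r: "r > 0" and m: "0 < m" "m \<le> cmod (Determinant.det (A - z0 \<cdot>\<^sub>m 1\<^sub>m n))"
    and M: "\<And>z. z \<in> cball z0 r \<Longrightarrow> cmod (Determinant.det (A - z \<cdot>\<^sub>m 1\<^sub>m n)) \<le> M"
  shows "2 ^ eigenvalue_count A (cball z0 (r / 3)) * m \<le> M"
proof -
  have "2 ^ eigenvalue_count A (cball z0 (r / 3)) * m
      \<le> 2 ^ eigenvalue_count A (cball z0 (r / 3)) * cmod (poly (char_poly A) z0)"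
    using m(2) unfolding cmod_poly_char_poly[OF A] by (intro mult_left_mono) auto
  also have "\<dots> \<le> M" unfolding eigenvalue_count_eq[OF A]
  proof (rule proots_count_cball_le[OF r])
    show "poly (char_poly A) z0 \<noteq> 0" using m cmod_poly_char_poly[OF A, of z0] by auto
  qed (simp only: cmod_poly_char_poly[OF A] M)
  finally show ?thesis .
qed

section \<open>Complex Gaussian variables and small determinants\<close>

definition complex_gaussian_density :: "complex \<Rightarrow> ennreal" where
  "complex_gaussian_density q = ennreal (exp (- (norm q)\<^sup>2) / pi)"

lemma complex_gaussian_density_measurable [measurable]:
  "complex_gaussian_density \<in> borel_measurable borel"
  unfolding complex_gaussian_density_def by measurable

lemma lborel_complex_scale:
  assumes "c > 0" "f \<in> borel_measurable borel"
  shows "(\<integral>\<^sup>+q. f q \<partial>lborel) = ennreal (c\<^sup>2) * (\<integral>\<^sup>+q. f (c *\<^sub>R q) \<partial>(lborel :: complex measure))"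
proof -
  note [measurable] = assms(2)
  have "(\<integral>\<^sup>+q. f q \<partial>lborel)
      = (\<integral>\<^sup>+q. f q \<partial>density (distr lborel borel (\<lambda>x::complex. 0 + c *\<^sub>R x)) (\<lambda>_. \<bar>c\<bar>^DIM(complex)))"
    using assms(1) by (subst lborel_affine[of c 0, symmetric]) auto
  thus ?thesis
    by (simp add: nn_integral_density nn_integral_distr nn_integral_cmult)
qed

text \<open>On |q| > s half of the exponent is at least s^2/2 and is split off; the rest,
  exp(-|q|^2/2)/pi, integrates to 2 by scaling with sqrt 2. The total mass 1 is read off from the
  law of \<open>X\<close>, so no Gaussian integral is computed.\<close>

lemma (in prob_space) complex_gaussian_tail:
  assumes X: "distributed M lborel X complex_gaussian_density" and s: "s \<ge> 0"
  shows "prob {\<omega>\<in>space M. s < cmod (X \<omega>)} \<le> 2 * exp (- s\<^sup>2 / 2)"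
proof -
  have one: "(\<integral>\<^sup>+q. complex_gaussian_density q \<partial>lborel) = 1"
    using distributed_nn_integral[OF X, of "\<lambda>_. 1"] by (simp add: emeasure_space_1)
  define g :: "complex \<Rightarrow> ennreal" where "g q = ennreal (exp (- (norm q)\<^sup>2 / 2) / pi)" for q
  have [measurable]: "g \<in> borel_measurable borel" unfolding g_def by measurable
  have "(\<integral>\<^sup>+q. g q \<partial>lborel) = ennreal ((sqrt 2)\<^sup>2) * (\<integral>\<^sup>+q. g (sqrt 2 *\<^sub>R q) \<partial>lborel)"
    by (rule lborel_complex_scale) auto
  also have "(\<lambda>q. g (sqrt 2 *\<^sub>R q)) = complex_gaussian_density"
    by (auto simp: g_def complex_gaussian_density_def power_mult_distrib)
  finally have g2: "(\<integral>\<^sup>+q. g q \<partial>lborel) = 2" using one by simp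
  have "emeasure M {\<omega>\<in>space M. s < cmod (X \<omega>)} = emeasure M (X -` {q. s < cmod q} \<inter> space M)"
    by (intro arg_cong[where f = "emeasure M"]) auto
  also have "\<dots> = (\<integral>\<^sup>+q. complex_gaussian_density q * indicator {q. s < cmod q} q \<partial>lborel)"
    by (rule distributed_emeasure[OF X]) measurable
  also have "\<dots> \<le> (\<integral>\<^sup>+q. ennreal (exp (- s\<^sup>2 / 2)) * g q \<partial>lborel)"
  proof (rule nn_integral_mono)
    fix q :: complex
    have "exp (- (norm q)\<^sup>2) \<le> exp (- s\<^sup>2 / 2) * exp (- (norm q)\<^sup>2 / 2)" if "s < cmod q"
    proof -
      have "s\<^sup>2 \<le> (norm q)\<^sup>2" using that s by (intro power_mono) auto
      thus ?thesis by (simp flip: exp_add)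
    qed
    thus "complex_gaussian_density q * indicator {q. s < cmod q} q \<le> ennreal (exp (- s\<^sup>2 / 2)) * g q"
      unfolding complex_gaussian_density_def g_def
      by (auto simp: indicator_def divide_right_mono simp flip: ennreal_mult' intro!: ennreal_leI)
  qed
  also have "\<dots> = ennreal (2 * exp (- s\<^sup>2 / 2))"
    using g2 by (subst nn_integral_cmult) (auto simp: ennreal_mult' mult.commute)
  finally show ?thesis
    by (simp add: emeasure_eq_measure)
qed

text \<open>Once \<open>Y\<close> is fixed, g(X) must lie in a ball of radius \<tau> / b, hence of
  area pi (\<tau> / b)^2, and the Gaussian density is at most 1/pi. The coordinate map
  \<open>g\<close> appears because splitting an independent family yields variables with values in
  product spaces, even for a single index.\<close>

lemma (in prob_space) complex_gaussian_affine_small_ball: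
  assumes X: "distributed M lborel (\<lambda>\<omega>. g (X \<omega>)) complex_gaussian_density"
    and indep: "indep_var T X S Y"
    and [measurable]: "g \<in> borel_measurable T" "\<alpha> \<in> borel_measurable S" "\<beta> \<in> borel_measurable S"
    and b: "b > 0" and \<tau>: "\<tau> \<ge> 0"
  shows "prob {\<omega>\<in>space M. cmod (\<alpha> (Y \<omega>) + \<beta> (Y \<omega>) * g (X \<omega>)) < \<tau> \<and> b \<le> cmod (\<beta> (Y \<omega>))} \<le> (\<tau> / b)\<^sup>2"
proof -
  have [measurable]: "random_variable T X" "random_variable S Y"
    using indep by (auto dest: indep_var_rv1 indep_var_rv2)
  \<comment> \<open>Independence makes the joint law a product, so the event can be measured slice
    by slice in y.\<close>
  have joint: "distr M T X \<Otimes>\<^sub>M distr M S Y = distr M (T \<Otimes>\<^sub>M S) (\<lambda>\<omega>. (X \<omega>, Y \<omega>))"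
    using indep unfolding indep_var_distribution_eq by blast
  interpret DX: prob_space "distr M T X" by (rule prob_space_distr) measurable
  interpret DY: prob_space "distr M S Y" by (rule prob_space_distr) measurable
  interpret DXY: pair_sigma_finite "distr M T X" "distr M S Y" ..
  define E where "E = {p\<in>space (T \<Otimes>\<^sub>M S). cmod (\<alpha> (snd p) + \<beta> (snd p) * g (fst p)) < \<tau> \<and> b \<le> cmod (\<beta> (snd p))}"
  have E: "E \<in> sets (T \<Otimes>\<^sub>M S)" unfolding E_def by measurable
  have ball: "emeasure (distr M T X) A \<le> ennreal ((\<tau> / b)\<^sup>2)"
    if A: "A \<in> sets T" "A \<subseteq> g -` ball c (\<tau> / b)" for A c
  proof -
    have "emeasure (distr M T X) A = emeasure M (X -` A \<inter> space M)"
      using A(1) by (subst emeasure_distr) auto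
    also have "\<dots> \<le> emeasure M ((\<lambda>\<omega>. g (X \<omega>)) -` ball c (\<tau> / b) \<inter> space M)"
      using A(2) by (intro emeasure_mono) (auto intro!: measurable_sets_borel)
    also have "\<dots> = (\<integral>\<^sup>+q. complex_gaussian_density q * indicator (ball c (\<tau> / b)) q \<partial>lborel)"
      by (intro distributed_emeasure[OF X]) auto
    also have "\<dots> \<le> (\<integral>\<^sup>+q. ennreal (1 / pi) * indicator (ball c (\<tau> / b)) q \<partial>lborel)"
      unfolding complex_gaussian_density_def
      by (intro nn_integral_mono mult_right_mono ennreal_leI divide_right_mono) auto
    also have "\<dots> = ennreal (1 / pi) * ennreal (pi * (\<tau> / b)\<^sup>2)"
      using \<tau> b by (subst nn_integral_cmult_indicator) (auto simp: emeasure_ball unit_ball_vol_2)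
    also have "\<dots> = ennreal ((\<tau> / b)\<^sup>2)"
      by (simp flip: ennreal_mult')
    finally show ?thesis .
  qed
  have "emeasure M {\<omega>\<in>space M. cmod (\<alpha> (Y \<omega>) + \<beta> (Y \<omega>) * g (X \<omega>)) < \<tau> \<and> b \<le> cmod (\<beta> (Y \<omega>))}
      = emeasure (distr M (T \<Otimes>\<^sub>M S) (\<lambda>\<omega>. (X \<omega>, Y \<omega>))) E"
    using E measurable_space[of Y M S] measurable_space[of X M T]
    by (subst emeasure_distr)
       (auto simp: E_def space_pair_measure intro!: arg_cong[where f = "emeasure M"])
  also have "\<dots> = (\<integral>\<^sup>+y. emeasure (distr M T X) ((\<lambda>x. (x, y)) -` E) \<partial>distr M S Y)"
    unfolding joint[symmetric] using E by (intro DXY.emeasure_pair_measure_alt2) simp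
  also have "\<dots> \<le> (\<integral>\<^sup>+y. ennreal ((\<tau> / b)\<^sup>2) \<partial>distr M S Y)"
  proof (rule nn_integral_mono)
    fix y
    show "emeasure (distr M T X) ((\<lambda>x. (x, y)) -` E) \<le> ennreal ((\<tau> / b)\<^sup>2)"
    proof (rule ball)
      show "(\<lambda>x. (x, y)) -` E \<in> sets T"
        using sets_Pair2[OF E] by simp
      show "(\<lambda>x. (x, y)) -` E \<subseteq> g -` ball (- \<alpha> y / \<beta> y) (\<tau> / b)"
      proof
        fix x assume "x \<in> (\<lambda>x. (x, y)) -` E"
        hence x: "cmod (\<alpha> y + \<beta> y * g x) < \<tau>" and \<beta>: "b \<le> cmod (\<beta> y)" unfolding E_def by auto
        have "\<beta> y \<noteq> 0" using \<beta> b by auto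
        hence "\<alpha> y + \<beta> y * g x = - (\<beta> y * (- \<alpha> y / \<beta> y - g x))" by (simp add: field_simps)
        hence "b * dist (- \<alpha> y / \<beta> y) (g x) \<le> cmod (\<alpha> y + \<beta> y * g x)"
          using \<beta> by (simp only: norm_minus_cancel norm_mult dist_norm mult_right_mono norm_ge_zero)
        thus "x \<in> g -` ball (- \<alpha> y / \<beta> y) (\<tau> / b)" using x b by (simp add: field_simps)
      qed
    qed
  qed
  also have "\<dots> = ennreal ((\<tau> / b)\<^sup>2)" using DY.emeasure_space_1 by simp
  finally show ?thesis by (simp add: emeasure_eq_measure)
qed

lemma det_measurable:
  fixes F :: "'x \<Rightarrow> complex mat"
  assumes carrier: "\<And>x. x \<in> space M \<Longrightarrow> F x \<in> carrier_mat n n"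
    and meas: "\<And>i j. i < n \<Longrightarrow> j < n \<Longrightarrow> (\<lambda>x. F x $$ (i, j)) \<in> borel_measurable M"
  shows "(\<lambda>x. Determinant.det (F x)) \<in> borel_measurable M"
proof -
  have "(\<lambda>x. Determinant.det (F x)) \<in> borel_measurable M \<longleftrightarrow>
    (\<lambda>x. \<Sum>p\<in>{p. p permutes {0..<n}}. signof p * (\<Prod>i = 0..<n. F x $$ (i, p i))) \<in> borel_measurable M"
    using det_def'[OF carrier] by (intro measurable_cong) simp
  also have \<dots>
    by (intro borel_measurable_sum borel_measurable_times borel_measurable_prod borel_measurable_const meas)
       (auto dest: permutes_in_image)
  finally show ?thesis .
qed

text \<open>The slope in the corner entry is a minor that is known to be large only under the
  truncation; hence the truncation is part of the event. It is then weakened to a lower bound on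
  |\<beta>(Y)|, which does not involve the corner entry, so that independence can be used.\<close>

lemma (in prob_space) small_det_prob_le:
  assumes iid: "iid_complex_gaussian_matrix M (Suc m) Q"
    and a: "a \<noteq> 0" and c: "c > 0" and \<delta>: "\<delta> > 0" and s: "s \<ge> 0" and \<tau>: "\<tau> \<ge> 0"
    and lower: "\<And>m x. x \<in> carrier_vec m \<Longrightarrow> c * norm1 x \<le> norm1 (lower_toeplitz m a b z *\<^sub>v x)"
    and small: "real (Suc m) * (\<delta> * s) \<le> c / 2"
  shows "prob {\<omega>\<in>space M. cmod (Determinant.det (bidiag_toeplitz (Suc m) a b
        + complex_of_real \<delta> \<cdot>\<^sub>m Q \<omega> - z \<cdot>\<^sub>m 1\<^sub>m (Suc m))) < \<tau> \<and> (\<forall>i<Suc m. \<forall>j<Suc m. cmod (Q \<omega> $$ (i, j)) \<le> s)}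
    \<le> (\<tau> * (1 + 2 * real (Suc m) * (\<delta> * s) / c) ^ Suc m / (\<delta> * cmod a ^ m))\<^sup>2"
proof -
  define L where "L = (1 + 2 * real (Suc m) * (\<delta> * s) / c) ^ Suc m"
  have L: "L > 0" unfolding L_def using \<delta> s c by (intro zero_less_power add_pos_nonneg) auto
  define J where "J = {..<Suc m} \<times> {..<Suc m}"
  define K where "K = J - {(m, 0)}"
  define X where "X = (\<lambda>\<omega>. restrict (\<lambda>jk. Q \<omega> $$ jk) {(m, 0)})"
  define Y where "Y = (\<lambda>\<omega>. restrict (\<lambda>jk. Q \<omega> $$ jk) K)"
  define S where "S = PiM K (\<lambda>_. borel :: complex measure)"
  have carrier: "Q \<omega> \<in> carrier_mat (Suc m) (Suc m)" if "\<omega> \<in> space M" for \<omega>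
    using iid that unfolding iid_complex_gaussian_matrix_def by auto
  have indep: "indep_vars (\<lambda>_. borel) (\<lambda>jk \<omega>. Q \<omega> $$ jk) J"
    using iid unfolding iid_complex_gaussian_matrix_def J_def by auto
  have X: "distributed M lborel (\<lambda>\<omega>. X \<omega> (m, 0)) complex_gaussian_density"
    using iid unfolding iid_complex_gaussian_matrix_def X_def complex_gaussian_density_def[abs_def] by auto
  define T where "T = PiM {(m, 0 :: nat)} (\<lambda>_. borel :: complex measure)"
  have XY: "indep_var T X S Y"
    unfolding T_def X_def S_def Y_def by (rule indep_var_restrict[OF indep]) (auto simp: K_def J_def)
  have g: "(\<lambda>f. f (m, 0)) \<in> borel_measurable T"
    unfolding T_def by (intro measurable_component_singleton) auto
  define P0 where "P0 = bidiag_toeplitz (Suc m) a b - z \<cdot>\<^sub>m 1\<^sub>m (Suc m)"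
  \<comment> \<open>This is P_delta - z with the corner entry \<open>x\<close> separated from the
    other entries \<open>y\<close>.\<close>
  define G where "G y x = mat (Suc m) (Suc m) (\<lambda>(i, j). P0 $$ (i, j) + complex_of_real \<delta> * (if (i, j) = (m, 0) then x else y (i, j)))"
    for y x
  have G: "G y x \<in> carrier_mat (Suc m) (Suc m)" for y x unfolding G_def by simp
  define \<alpha> where "\<alpha> y = Determinant.det (G y 0)" for y
  define \<beta> where "\<beta> y = complex_of_real \<delta> * cofactor (G y 0) m 0" for y
  \<comment> \<open>The corner lies in column 0, so no minor along that column contains
    \<open>x\<close>; hence the determinant is affine in \<open>x\<close>.\<close>
  have minor: "mat_delete (G y x) i 0 = mat_delete (G y 0) i 0" for i y x
    unfolding mat_delete_def G_def by (intro eq_matI) auto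
  have affine: "Determinant.det (G y x) = \<alpha> y + \<beta> y * x" for y x
  proof -
    have "Determinant.det (G y x) = (\<Sum>i<Suc m. G y x $$ (i, 0) * cofactor (G y x) i 0)"
      by (rule laplace_expansion_column[OF G]) simp
    also have "\<dots> = (\<Sum>i<Suc m. G y 0 $$ (i, 0) * cofactor (G y 0) i 0 + (if i = m then \<beta> y * x else 0))"
    proof (rule sum.cong)
      fix i assume "i \<in> {..<Suc m}"
      moreover have "cofactor (G y x) i 0 = cofactor (G y 0) i 0"
        unfolding cofactor_def by (subst minor) (rule refl)
      ultimately show "G y x $$ (i, 0) * cofactor (G y x) i 0
          = G y 0 $$ (i, 0) * cofactor (G y 0) i 0 + (if i = m then \<beta> y * x else 0)"
        by (auto simp: \<beta>_def G_def[of y x] G_def[of y 0] algebra_simps)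
    qed simp
    also have "\<dots> = \<alpha> y + \<beta> y * x"
      unfolding \<alpha>_def by (subst laplace_expansion_column[OF G, of 0]) (simp_all add: sum.distrib)
    finally show ?thesis .
  qed
  have comp: "(\<lambda>y. y (i, j)) \<in> borel_measurable S" if "i < Suc m" "j < Suc m" "(i, j) \<noteq> (m, 0)" for i j
    unfolding S_def using that by (intro measurable_component_singleton) (auto simp: K_def J_def)
  have \<alpha>: "\<alpha> \<in> borel_measurable S"
    unfolding \<alpha>_def[abs_def]
  proof (rule det_measurable[OF G])
    fix i j assume ij: "i < Suc m" "j < Suc m"
    show "(\<lambda>y. G y 0 $$ (i, j)) \<in> borel_measurable S"
      using ij comp[OF ij] by (cases "(i, j) = (m, 0)") (auto simp: G_def)
  qed
  have \<beta>: "\<beta> \<in> borel_measurable S"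
    unfolding \<beta>_def[abs_def] cofactor_def
  proof (intro borel_measurable_times borel_measurable_const det_measurable[where n = m])
    show "mat_delete (G y 0) m 0 \<in> carrier_mat m m" for y using mat_delete_carrier[OF G] by simp
    fix i j assume ij: "i < m" "j < m"
    hence "(\<lambda>y. mat_delete (G y 0) m 0 $$ (i, j)) = (\<lambda>y. P0 $$ (i, Suc j) + complex_of_real \<delta> * y (i, Suc j))"
      by (auto simp: mat_delete_def G_def)
    thus "(\<lambda>y. mat_delete (G y 0) m 0 $$ (i, j)) \<in> borel_measurable S"
      using comp[of i "Suc j"] ij by simp
  qed
  have [measurable]: "random_variable T X" "random_variable S Y"
    using XY by (auto dest: indep_var_rv1 indep_var_rv2)
  note [measurable] = g \<alpha> \<beta>
  define b0 where "b0 = \<delta> * cmod a ^ m / L"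
  have b0: "b0 > 0" unfolding b0_def using \<delta> a L by simp
  have "{\<omega>\<in>space M. cmod (Determinant.det (bidiag_toeplitz (Suc m) a b
        + complex_of_real \<delta> \<cdot>\<^sub>m Q \<omega> - z \<cdot>\<^sub>m 1\<^sub>m (Suc m))) < \<tau> \<and> (\<forall>i<Suc m. \<forall>j<Suc m. cmod (Q \<omega> $$ (i, j)) \<le> s)}
    \<subseteq> {\<omega>\<in>space M. cmod (\<alpha> (Y \<omega>) + \<beta> (Y \<omega>) * X \<omega> (m, 0)) < \<tau> \<and> b0 \<le> cmod (\<beta> (Y \<omega>))}"
  proof safe
    fix \<omega> assume \<omega>: "\<omega> \<in> space M" and q: "\<forall>i<Suc m. \<forall>j<Suc m. cmod (Q \<omega> $$ (i, j)) \<le> s"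
      and det: "cmod (Determinant.det (bidiag_toeplitz (Suc m) a b
        + complex_of_real \<delta> \<cdot>\<^sub>m Q \<omega> - z \<cdot>\<^sub>m 1\<^sub>m (Suc m))) < \<tau>"
    have eq: "bidiag_toeplitz (Suc m) a b + complex_of_real \<delta> \<cdot>\<^sub>m Q \<omega> - z \<cdot>\<^sub>m 1\<^sub>m (Suc m) = G (Y \<omega>) (X \<omega> (m, 0))"
      using carrier[OF \<omega>] unfolding G_def P0_def Y_def X_def K_def J_def bidiag_toeplitz_def
      by (intro eq_matI) auto
    show "cmod (\<alpha> (Y \<omega>) + \<beta> (Y \<omega>) * X \<omega> (m, 0)) < \<tau>" using det unfolding eq affine .
    have "cmod a ^ m \<le> cmod (Determinant.det (mat_delete (bidiag_toeplitz (Suc m) a b + complex_of_real \<delta> \<cdot>\<^sub>m Q \<omega> - z \<cdot>\<^sub>m 1\<^sub>m (Suc m)) m 0)) * L"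
      unfolding L_def
      by (rule cmod_minor_bidiag_toeplitz_ge[OF _ c _ _ lower small])
         (use carrier[OF \<omega>] q \<delta> s in \<open>auto simp: norm_mult\<close>)
    moreover have "mat_delete (G (Y \<omega>) (X \<omega> (m, 0))) m 0 = mat_delete (G (Y \<omega>) 0) m 0" by (rule minor)
    ultimately have "cmod a ^ m / L \<le> cmod (Determinant.det (mat_delete (G (Y \<omega>) 0) m 0))"
      unfolding eq using L by (simp add: field_simps)
    from mult_left_mono[OF this, of \<delta>]
    show "b0 \<le> cmod (\<beta> (Y \<omega>))"
      unfolding b0_def \<beta>_def cofactor_def using \<delta> by (simp add: norm_mult norm_power)
  qed
  hence "prob {\<omega>\<in>space M. cmod (Determinant.det (bidiag_toeplitz (Suc m) a b
        + complex_of_real \<delta> \<cdot>\<^sub>m Q \<omega> - z \<cdot>\<^sub>m 1\<^sub>m (Suc m))) < \<tau> \<and> (\<forall>i<Suc m. \<forall>j<Suc m. cmod (Q \<omega> $$ (i, j)) \<le> s)}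
    \<le> prob {\<omega>\<in>space M. cmod (\<alpha> (Y \<omega>) + \<beta> (Y \<omega>) * X \<omega> (m, 0)) < \<tau> \<and> b0 \<le> cmod (\<beta> (Y \<omega>))}"
    by (intro finite_measure_mono) measurable
  also have "\<dots> \<le> (\<tau> / b0)\<^sup>2"
    by (rule complex_gaussian_affine_small_ball[OF X XY g \<alpha> \<beta> b0 \<tau>])
  also have "\<tau> / b0 = \<tau> * L / (\<delta> * cmod a ^ m)" unfolding b0_def by simp
  finally show ?thesis unfolding L_def .
qed

text \<open>Union bound over the N^2 tails and the finitely many centres. Outside all tail events
  the truncation holds, so there avoiding the events \<open>V\<close> forces large
  determinants.\<close>

lemma (in prob_space) large_det_event:
  fixes zs :: "'i \<Rightarrow> complex" and c :: "'i \<Rightarrow> real"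
  assumes iid: "iid_complex_gaussian_matrix M (Suc m) Q" and I: "finite I"
    and a: "a \<noteq> 0" and \<delta>: "\<delta> > 0" and s: "s \<ge> 0" and \<tau>: "\<tau> \<ge> 0"
    and c: "\<And>w. w \<in> I \<Longrightarrow> c w > 0"
    and lower: "\<And>w m x. w \<in> I \<Longrightarrow> x \<in> carrier_vec m \<Longrightarrow> c w * norm1 x \<le> norm1 (lower_toeplitz m a b (zs w) *\<^sub>v x)"
    and small: "\<And>w. w \<in> I \<Longrightarrow> real (Suc m) * (\<delta> * s) \<le> c w / 2"
  shows "\<exists>A\<in>events. (\<forall>\<omega>\<in>A. (\<forall>i<Suc m. \<forall>j<Suc m. cmod (Q \<omega> $$ (i, j)) \<le> s) \<and>
      (\<forall>w\<in>I. \<tau> \<le> cmod (Determinant.det (bidiag_toeplitz (Suc m) a b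
        + complex_of_real \<delta> \<cdot>\<^sub>m Q \<omega> - zs w \<cdot>\<^sub>m 1\<^sub>m (Suc m))))) \<and>
    prob A \<ge> 1 - (2 * (real (Suc m))\<^sup>2 * exp (- s\<^sup>2 / 2)
      + (\<Sum>w\<in>I. (\<tau> * (1 + 2 * real (Suc m) * (\<delta> * s) / c w) ^ Suc m / (\<delta> * cmod a ^ m))\<^sup>2))"
proof -
  define J where "J = {..<Suc m} \<times> {..<Suc m}"
  define D where "D w \<omega> = cmod (Determinant.det (bidiag_toeplitz (Suc m) a b
        + complex_of_real \<delta> \<cdot>\<^sub>m Q \<omega> - zs w \<cdot>\<^sub>m 1\<^sub>m (Suc m)))" for w \<omega>
  define U where "U jk = {\<omega>\<in>space M. s < cmod (Q \<omega> $$ jk)}" for jk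
  define V where "V w = {\<omega>\<in>space M. D w \<omega> < \<tau> \<and> (\<forall>i<Suc m. \<forall>j<Suc m. cmod (Q \<omega> $$ (i, j)) \<le> s)}" for w
  have carrier: "Q \<omega> \<in> carrier_mat (Suc m) (Suc m)" if "\<omega> \<in> space M" for \<omega>
    using iid that unfolding iid_complex_gaussian_matrix_def by auto
  have dist: "distributed M lborel (\<lambda>\<omega>. Q \<omega> $$ jk) complex_gaussian_density" if "jk \<in> J" for jk
    using iid that unfolding iid_complex_gaussian_matrix_def complex_gaussian_density_def[abs_def] J_def by auto
  have meas: "random_variable borel (\<lambda>\<omega>. Q \<omega> $$ (i, j))" if "i < Suc m" "j < Suc m" for i j
    using distributed_measurable[OF dist[of "(i, j)"]] that unfolding J_def by simp
  have D: "random_variable borel (D w)" for w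
    unfolding D_def[abs_def]
  proof (intro measurable_compose[OF _ borel_measurable_norm] det_measurable[where n = "Suc m"])
    fix i j assume ij: "i < Suc m" "j < Suc m"
    have "(\<lambda>\<omega>. (bidiag_toeplitz (Suc m) a b + complex_of_real \<delta> \<cdot>\<^sub>m Q \<omega> - zs w \<cdot>\<^sub>m 1\<^sub>m (Suc m)) $$ (i, j)) \<in> borel_measurable M
      \<longleftrightarrow> (\<lambda>\<omega>. (bidiag_toeplitz (Suc m) a b $$ (i, j) - zs w * 1\<^sub>m (Suc m) $$ (i, j)) + complex_of_real \<delta> * Q \<omega> $$ (i, j)) \<in> borel_measurable M"
    proof (rule measurable_cong)
      fix \<omega> assume "\<omega> \<in> space M"
      from carrier[OF this] ij
      show "(bidiag_toeplitz (Suc m) a b + complex_of_real \<delta> \<cdot>\<^sub>m Q \<omega> - zs w \<cdot>\<^sub>m 1\<^sub>m (Suc m)) $$ (i, j)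
        = (bidiag_toeplitz (Suc m) a b $$ (i, j) - zs w * 1\<^sub>m (Suc m) $$ (i, j)) + complex_of_real \<delta> * Q \<omega> $$ (i, j)"
        by (auto simp: bidiag_toeplitz_def)
    qed
    also have \<dots> using meas[OF ij] by measurable
    finally show "(\<lambda>\<omega>. (bidiag_toeplitz (Suc m) a b + complex_of_real \<delta> \<cdot>\<^sub>m Q \<omega> - zs w \<cdot>\<^sub>m 1\<^sub>m (Suc m)) $$ (i, j)) \<in> borel_measurable M" .
  qed (use carrier in auto)
  have U: "U jk \<in> events" if "jk \<in> J" for jk
    unfolding U_def using meas[of "fst jk" "snd jk"] that by (auto simp: J_def intro: borel_measurable_less)
  have V: "V w \<in> events" for w
  proof -
    \<comment> \<open>For measurability, the truncation is expressed as the complement of finitely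
      many tail events.\<close>
    have "V w = {\<omega>\<in>space M. D w \<omega> < \<tau>} - (\<Union>jk\<in>J. U jk)"
    proof (rule Set.set_eqI)
      fix \<omega>
      have "\<omega> \<in> (\<Union>jk\<in>J. U jk) \<longleftrightarrow> \<omega> \<in> space M \<and> \<not> (\<forall>i<Suc m. \<forall>j<Suc m. cmod (Q \<omega> $$ (i, j)) \<le> s)"
        unfolding U_def J_def by (simp add: not_le Bex_def)
      thus "\<omega> \<in> V w \<longleftrightarrow> \<omega> \<in> {\<omega>\<in>space M. D w \<omega> < \<tau>} - (\<Union>jk\<in>J. U jk)"
        unfolding V_def by blast
    qed
    moreover have "{\<omega>\<in>space M. D w \<omega> < \<tau>} \<in> events" using D by measurable
    moreover have "(\<Union>jk\<in>J. U jk) \<in> events" using U by (intro sets.finite_UN) (auto simp: J_def)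
    ultimately show ?thesis by auto
  qed
  define B where "B = (\<Union>jk\<in>J. U jk) \<union> (\<Union>w\<in>I. V w)"
  have UB: "(\<Union>jk\<in>J. U jk) \<in> events" "(\<Union>w\<in>I. V w) \<in> events"
    using U V I by (auto simp: J_def intro!: sets.finite_UN)
  have B: "B \<in> events" unfolding B_def using UB by auto
  have "prob B \<le> prob (\<Union>jk\<in>J. U jk) + prob (\<Union>w\<in>I. V w)"
    unfolding B_def using UB by (rule measure_Un_le)
  also have "\<dots> \<le> (\<Sum>jk\<in>J. prob (U jk)) + (\<Sum>w\<in>I. prob (V w))"
    using U V I by (intro add_mono finite_measure_subadditive_finite) (auto simp: J_def)
  also have "\<dots> \<le> (\<Sum>jk\<in>J. 2 * exp (- s\<^sup>2 / 2))
      + (\<Sum>w\<in>I. (\<tau> * (1 + 2 * real (Suc m) * (\<delta> * s) / c w) ^ Suc m / (\<delta> * cmod a ^ m))\<^sup>2)"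
    unfolding U_def V_def D_def
    by (intro add_mono sum_mono complex_gaussian_tail[OF dist s] small_det_prob_le[OF iid a c \<delta> s \<tau> lower small])
  also have "(\<Sum>jk\<in>J. 2 * exp (- s\<^sup>2 / 2)) = 2 * (real (Suc m))\<^sup>2 * exp (- s\<^sup>2 / 2)"
    unfolding J_def by (simp add: card_cartesian_product power2_eq_square algebra_simps)
  finally have prob: "prob B \<le> 2 * (real (Suc m))\<^sup>2 * exp (- s\<^sup>2 / 2)
      + (\<Sum>w\<in>I. (\<tau> * (1 + 2 * real (Suc m) * (\<delta> * s) / c w) ^ Suc m / (\<delta> * cmod a ^ m))\<^sup>2)" .
  show ?thesis
  proof (intro bexI[of _ "space M - B"] conjI ballI)
    show "space M - B \<in> events" using B by auto
    show "prob (space M - B) \<ge> 1 - (2 * (real (Suc m))\<^sup>2 * exp (- s\<^sup>2 / 2)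
      + (\<Sum>w\<in>I. (\<tau> * (1 + 2 * real (Suc m) * (\<delta> * s) / c w) ^ Suc m / (\<delta> * cmod a ^ m))\<^sup>2))"
      using prob prob_compl[OF B] by simp
    fix \<omega> assume \<omega>: "\<omega> \<in> space M - B"
    show q: "\<forall>i<Suc m. \<forall>j<Suc m. cmod (Q \<omega> $$ (i, j)) \<le> s"
      using \<omega> unfolding B_def U_def J_def by force
    fix w assume w: "w \<in> I"
    have "\<not> D w \<omega> < \<tau>" using \<omega> w q unfolding B_def V_def by auto
    thus "\<tau> \<le> cmod (Determinant.det (bidiag_toeplitz (Suc m) a b
        + complex_of_real \<delta> \<cdot>\<^sub>m Q \<omega> - zs w \<cdot>\<^sub>m 1\<^sub>m (Suc m)))" unfolding D_def by simp
  qed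
qed

text \<open>Two compactness arguments. The unit circle is mapped into the interior of \<Gamma>, so
  the points of the annulus 1 <= |w| <= 2 mapped outside it keep a positive distance from the
  circle, which gives \<eta>. The points of the closed disc mapped outside it form a compact subset
  of the open disc, which gives the finite set \<open>I\<close>.\<close>

lemma filled_ellipse_cover:
  fixes a b :: complex and r :: "complex \<Rightarrow> real"
  defines "l w \<equiv> a * w + b * cnj w"
  assumes sub: "symbol_ellipse a b \<subseteq> interior \<Gamma>" and r: "\<And>w. cmod w < 1 \<Longrightarrow> r w > 0"
  shows "\<exists>\<eta>>0. \<exists>I. finite I \<and> (\<forall>v\<in>I. cmod v < 1) \<and>
    (\<forall>w. cmod w \<le> 1 + \<eta> \<longrightarrow> l w \<notin> \<Gamma> \<longrightarrow> (\<exists>v\<in>I. l w \<in> cball (l v) (r v)))"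
proof -
  have cont: "continuous_on A l" for A unfolding l_def by (intro continuous_intros)
  have circle: "l w \<in> interior \<Gamma>" if "cmod w = 1" for w
  proof -
    have "w = cis (Arg w)" using that by (metis cis_Arg sgn_eq norm_eq_zero zero_neq_one div_by_1 of_real_1)
    hence "l w = toeplitz_symbol a b (Arg w)"
      unfolding l_def toeplitz_symbol_def by (metis cis_cnj cis_conv_exp exp_minus cis_inverse)
    thus ?thesis using sub unfolding symbol_ellipse_def by auto
  qed
  define G where "G = l -` interior \<Gamma>"
  have G: "open G" unfolding G_def using cont[of UNIV] by (intro open_vimage) auto
  define K2 where "K2 = cball 0 2 - ball 0 1 - G"
  have "compact K2" unfolding K2_def using G by (intro compact_diff) auto
  have "\<exists>\<eta>>0. \<eta> \<le> 1 \<and> (\<forall>w\<in>K2. 1 + \<eta> < cmod w)"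
  proof (cases "K2 = {}")
    case True thus ?thesis by (intro exI[of _ 1]) auto
  next
    case False
    obtain w0 where w0: "w0 \<in> K2" "\<And>w. w \<in> K2 \<Longrightarrow> cmod w0 \<le> cmod w"
      using continuous_attains_inf[OF \<open>compact K2\<close> False, of cmod] by (auto intro: continuous_intros)
    have "cmod w0 \<noteq> 1" using w0(1) circle unfolding K2_def G_def by auto
    hence "1 < cmod w0" "cmod w0 \<le> 2" using w0(1) unfolding K2_def by auto
    \<comment> \<open>Half of the gap between the circle and the nearest point of \<open>K2\<close>
      keeps the inequality strict.\<close>
    thus ?thesis using w0(2) by (intro exI[of _ "(cmod w0 - 1) / 2"]) (auto simp: field_simps, smt (verit))
  qed
  then obtain \<eta> where \<eta>: "\<eta> > 0" "\<eta> \<le> 1" "\<And>w. w \<in> K2 \<Longrightarrow> 1 + \<eta> < cmod w" by blast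
  define K where "K = cball 0 1 - G"
  have K: "compact K" unfolding K_def using G by (intro compact_diff) auto
  have K1: "cmod v < 1" if "v \<in> K" for v
  proof -
    have "cmod v \<noteq> 1" using that circle unfolding K_def G_def by auto
    thus ?thesis using that unfolding K_def by auto
  qed
  have "K \<subseteq> (\<Union>v\<in>K. l -` ball (l v) (r v))" using K1 r by auto
  moreover have "open (l -` ball (l v) (r v))" for v using cont[of UNIV] by (intro open_vimage) auto
  ultimately obtain I where I: "I \<subseteq> K" "finite I" "K \<subseteq> (\<Union>v\<in>I. l -` ball (l v) (r v))"
    using compactE_image[OF K, of K "\<lambda>v. l -` ball (l v) (r v)"] by metis
  have "\<exists>v\<in>I. l w \<in> cball (l v) (r v)" if w: "cmod w \<le> 1 + \<eta>" "l w \<notin> \<Gamma>" for w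
  proof -
    have "w \<notin> G" using w(2) interior_subset unfolding G_def by auto
    moreover have "w \<notin> K2" using \<eta>(3)[of w] w(1) by auto
    ultimately have "w \<in> K" using w(1) \<eta>(2) unfolding K_def K2_def by auto
    then obtain v where "v \<in> I" "l w \<in> ball (l v) (r v)" using I(3) by auto
    thus ?thesis using ball_subset_cball by blast
  qed
  thus ?thesis using \<eta>(1) I K1 by blast
qed

section \<open>The eigenvalue count\<close>

lemma power_one_plus_le_exp:
  assumes "0 \<le> x" "real n * x \<le> y"
  shows "(1 + x) ^ n \<le> exp y"
proof -
  have "(1 + x) ^ n \<le> exp x ^ n" using assms(1) by (intro power_mono exp_ge_add_one_self) auto
  also have "\<dots> = exp (real n * x)" by (simp add: exp_of_nat_mult)
  also have "\<dots> \<le> exp y" using assms(2) by simp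
  finally show ?thesis .
qed

text \<open>The restriction to exponents below 1 keeps N^2 \<delta> s bounded; larger exponents are
  settled by the trivial count.\<close>

lemma eigenvalue_count_ellipse_bound:
  fixes a b :: complex and \<Gamma> :: "complex set"
  assumes ab: "cmod b < cmod a" and sub: "symbol_ellipse a b \<subseteq> interior \<Gamma>"
    and C0: "C\<^sub>0 \<ge> 1" and \<kappa>: "\<kappa> > 5 / 2" and d0: "\<delta>\<^sub>0 > 0" "\<delta>\<^sub>0 < 1"
  shows "\<exists>C::real. C > 0 \<and> (\<exists>N\<^sub>0::nat. \<forall>N\<ge>N\<^sub>0.
           \<forall>(\<delta>::real) (M :: 'w measure) (Q :: 'w \<Rightarrow> complex mat).
             inverse C\<^sub>0 * real N powr (- \<kappa>) \<le> \<delta> \<and> \<delta> \<le> C\<^sub>0 * real N powr (- \<kappa>) \<longrightarrow>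
             iid_complex_gaussian_matrix M N Q \<longrightarrow>
             holds_with_prob_ge M
               (1 - C * ln (real N) * real N powr (2 * \<kappa>) * exp (- 2 * real N powr \<delta>\<^sub>0))
               (\<lambda>\<omega>. real (eigenvalue_count
                        (bidiag_toeplitz N a b + complex_of_real \<delta> \<cdot>\<^sub>m Q \<omega>) (- \<Gamma>))
                      \<le> C * real N powr \<delta>\<^sub>0 * ln (real N)))"
proof -
  have a: "a \<noteq> 0" using ab by auto
  define l where "l w = a * w + b * cnj w" for w
  have "\<forall>w. \<exists>c. cmod w < 1 \<longrightarrow> c > 0 \<and> (\<forall>n z. \<forall>x\<in>carrier_vec n. cmod (z - l w) \<le> c \<longrightarrow>
    c * norm1 x \<le> norm1 (lower_toeplitz n a b z *\<^sub>v x))"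
    using lower_toeplitz_norm1_ge[OF ab] unfolding l_def by blast
  then obtain c where c: "\<And>w. cmod w < 1 \<Longrightarrow> c w > 0"
    and lower: "\<And>w n z x. cmod w < 1 \<Longrightarrow> x \<in> carrier_vec n \<Longrightarrow> cmod (z - l w) \<le> c w \<Longrightarrow>
      c w * norm1 x \<le> norm1 (lower_toeplitz n a b z *\<^sub>v x)"
    by metis
  \<comment> \<open>The radius is c / 3 because zeros are counted in a third of the disc on which
    the determinant is bounded.\<close>
  obtain \<eta> I where \<eta>: "\<eta> > 0" and I: "finite I" "\<And>v. v \<in> I \<Longrightarrow> cmod v < 1"
    and cover: "\<And>w. cmod w \<le> 1 + \<eta> \<Longrightarrow> l w \<notin> \<Gamma> \<Longrightarrow> \<exists>v\<in>I. l w \<in> cball (l v) (c v / 3)"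
    using filled_ellipse_cover[OF sub, of "\<lambda>w. c w / 3"] c unfolding l_def by (metis zero_less_divide_iff zero_less_numeral)
  \<comment> \<open>\<open>L w\<close> bounds |det| / |a|^N on a disc. \<open>C1\<close> comes from
    the zero counts, \<open>C2\<close> from small determinants at the centres, and the 2 in
    \<open>C\<close> from the Gaussian tails.\<close>
  define L where "L w = cmod a * (1 + (1 + cmod a) / c w) * exp (2 * C\<^sub>0 / c w)" for w
  define C1 where "C1 = (\<Sum>w\<in>I. (\<bar>ln (L w)\<bar> + 1) / ln 2)"
  define C2 where "C2 = (\<Sum>w\<in>I. (cmod a * exp (4 * C\<^sub>0 / c w) * C\<^sub>0)\<^sup>2)"
  define C where "C = C1 + C2 + 2"
  have C12: "C1 \<ge> 0" "C2 \<ge> 0" unfolding C1_def C2_def by (auto intro!: sum_nonneg)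
  have small_ev: "\<forall>\<^sub>F N in sequentially. 2 * C\<^sub>0 / real N \<le> t" if "t > 0" for t
  proof -
    have "(\<lambda>N. 2 * C\<^sub>0 / real N) \<longlonglongrightarrow> 0" by (rule lim_const_over_n)
    from order_tendstoD(2)[OF this that] show ?thesis by eventually_elim simp
  qed
  \<comment> \<open>N >= 3 gives ln N >= 1; the second condition is the smallness required for the
    minors; the third confines the eigenvalues to images of |w| <= 1 + \<eta>.\<close>
  have "\<forall>\<^sub>F N in sequentially. 3 \<le> N \<and> (\<forall>w\<in>I. 2 * C\<^sub>0 / real N \<le> c w / 2) \<and> 2 * C\<^sub>0 / real N \<le> \<eta> * (cmod a - cmod b)"
    using c I \<eta> ab
    by (intro eventually_conj eventually_ball_finite ballI small_ev eventually_ge_at_top) auto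
  then obtain N0 where N0: "\<And>N. N \<ge> N0 \<Longrightarrow> 3 \<le> N \<and> (\<forall>w\<in>I. 2 * C\<^sub>0 / real N \<le> c w / 2) \<and> 2 * C\<^sub>0 / real N \<le> \<eta> * (cmod a - cmod b)"
    unfolding eventually_sequentially by blast
  have "holds_with_prob_ge M
               (1 - C * ln (real N) * real N powr (2 * \<kappa>) * exp (- 2 * real N powr \<delta>\<^sub>0))
               (\<lambda>\<omega>. real (eigenvalue_count
                        (bidiag_toeplitz N a b + complex_of_real \<delta> \<cdot>\<^sub>m Q \<omega>) (- \<Gamma>))
                      \<le> C * real N powr \<delta>\<^sub>0 * ln (real N))"
    if N: "N \<ge> N0" and \<delta>: "inverse C\<^sub>0 * real N powr (- \<kappa>) \<le> \<delta>" "\<delta> \<le> C\<^sub>0 * real N powr (- \<kappa>)"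
      and iid: "iid_complex_gaussian_matrix M N Q"
    for N \<delta> and M :: "'w measure" and Q
  proof -
    interpret prob_space M using iid unfolding iid_complex_gaussian_matrix_def by blast
    have N3: "3 \<le> N" and small: "\<And>w. w \<in> I \<Longrightarrow> 2 * C\<^sub>0 / real N \<le> c w / 2"
      and near: "2 * C\<^sub>0 / real N \<le> \<eta> * (cmod a - cmod b)" using N0[OF N] by auto
    obtain m where m: "N = Suc m" using N3 by (cases N) auto
    define P where "P = real N powr \<delta>\<^sub>0"
    have P1: "P \<ge> 1" unfolding P_def using N3 d0 by (intro ge_one_powr_ge_zero) auto
    have lnN: "ln (real N) \<ge> 1"
    proof -
      have "exp 1 \<le> real N" using exp_le N3 by (meson numeral_le_real_of_nat_iff order.trans)
      thus ?thesis using N3 by (subst ln_ge_iff) auto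
    qed
    \<comment> \<open>Chosen so that the tail factor exp(-s^2/2) equals exp(-2 N^delta_0).\<close>
    define s where "s = 2 * real N powr (\<delta>\<^sub>0 / 2)"
    have s0: "s \<ge> 0" unfolding s_def by simp
    have s2: "s\<^sup>2 / 2 = 2 * P"
      unfolding s_def P_def power2_eq_square using powr_add[of "real N" "\<delta>\<^sub>0 / 2" "\<delta>\<^sub>0 / 2"] by simp
    have \<delta>0: "\<delta> > 0"
      using \<delta>(1) C0 N3 by (intro less_le_trans[OF _ \<delta>(1)]) auto
    have \<delta>s: "\<delta> * s \<ge> 0" using \<delta>0 s0 by simp
    have Ne: "real N * (\<delta> * s) \<le> 2 * C\<^sub>0 / real N"
    proof -
      have "real N * (\<delta> * s) \<le> real N * (C\<^sub>0 * real N powr (- \<kappa>) * s)"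
        using \<delta>(2) s0 by (intro mult_left_mono mult_right_mono) auto
      also have "\<dots> = 2 * C\<^sub>0 * (real N powr 1 * real N powr (- \<kappa>) * real N powr (\<delta>\<^sub>0 / 2))"
        unfolding s_def using N3 by simp
      also have "real N powr 1 * real N powr (- \<kappa>) * real N powr (\<delta>\<^sub>0 / 2) = real N powr (1 - \<kappa> + \<delta>\<^sub>0 / 2)"
        by (simp only: powr_add[symmetric]) simp
      \<comment> \<open>The exponent is below 1 - 5/2 + 1/2 = -1.\<close>
      also have "real N powr (1 - \<kappa> + \<delta>\<^sub>0 / 2) \<le> real N powr (- 1)"
        using N3 \<kappa> d0 by (intro powr_mono) auto
      also have "real N powr (- 1) = 1 / real N" using N3 by (simp add: powr_minus_divide)
      finally show ?thesis using C0 by (simp add: mult_left_mono)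
    qed
    \<comment> \<open>N columns, each with l^1 change at most N \<delta> s: the total is bounded, so
      the N-th powers below are bounded by constants.\<close>
    have NNe: "real N * (real N * (\<delta> * s)) \<le> 2 * C\<^sub>0"
      using mult_left_mono[OF Ne, of "real N"] N3 by simp
    have expU: "(1 + real N * (\<delta> * s) / c w) ^ N \<le> exp (2 * C\<^sub>0 / c w)" if "w \<in> I" for w
    proof (rule power_one_plus_le_exp)
      have cw: "c w > 0" using c I that by blast
      show "0 \<le> real N * (\<delta> * s) / c w" using \<delta>s cw by simp
      show "real N * (real N * (\<delta> * s) / c w) \<le> 2 * C\<^sub>0 / c w"
        using divide_right_mono[OF NNe, of "c w"] cw by simp
    qed
    have expL: "(1 + 2 * real N * (\<delta> * s) / c w) ^ N \<le> exp (4 * C\<^sub>0 / c w)" if "w \<in> I" for w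
    proof (rule power_one_plus_le_exp)
      have cw: "c w > 0" using c I that by blast
      show "0 \<le> 2 * real N * (\<delta> * s) / c w" using \<delta>s cw by simp
      have "real N * (2 * real N * (\<delta> * s)) \<le> 4 * C\<^sub>0" using NNe by (simp add: mult_ac)
      from divide_right_mono[OF this, of "c w"]
      show "real N * (2 * real N * (\<delta> * s) / c w) \<le> 4 * C\<^sub>0 / c w" using cw by simp
    qed
    \<comment> \<open>The square of exp(-P) supplies the exponent -2 N^delta_0 of the probability,
      and P itself is the price in the zero count.\<close>
    define \<tau> where "\<tau> = cmod a ^ N * exp (- P)"
    have \<tau>: "\<tau> > 0" unfolding \<tau>_def using a by simp
    define A where "A \<omega> = bidiag_toeplitz N a b + complex_of_real \<delta> \<cdot>\<^sub>m Q \<omega>" for \<omega>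
    obtain F where F: "F \<in> events"
      and q: "\<And>\<omega> i j. \<omega> \<in> F \<Longrightarrow> i < N \<Longrightarrow> j < N \<Longrightarrow> cmod (Q \<omega> $$ (i, j)) \<le> s"
      and det: "\<And>\<omega> w. \<omega> \<in> F \<Longrightarrow> w \<in> I \<Longrightarrow> \<tau> \<le> cmod (Determinant.det (A \<omega> - l w \<cdot>\<^sub>m 1\<^sub>m N))"
      and prob: "prob F \<ge> 1 - (2 * (real N)\<^sup>2 * exp (- s\<^sup>2 / 2)
        + (\<Sum>w\<in>I. (\<tau> * (1 + 2 * real N * (\<delta> * s) / c w) ^ N / (\<delta> * cmod a ^ m))\<^sup>2))"
    proof -
      have "\<exists>F\<in>events. (\<forall>\<omega>\<in>F. (\<forall>i<Suc m. \<forall>j<Suc m. cmod (Q \<omega> $$ (i, j)) \<le> s) \<and>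
          (\<forall>w\<in>I. \<tau> \<le> cmod (Determinant.det (bidiag_toeplitz (Suc m) a b
            + complex_of_real \<delta> \<cdot>\<^sub>m Q \<omega> - l w \<cdot>\<^sub>m 1\<^sub>m (Suc m))))) \<and>
        prob F \<ge> 1 - (2 * (real (Suc m))\<^sup>2 * exp (- s\<^sup>2 / 2)
          + (\<Sum>w\<in>I. (\<tau> * (1 + 2 * real (Suc m) * (\<delta> * s) / c w) ^ Suc m / (\<delta> * cmod a ^ m))\<^sup>2))"
      proof (rule large_det_event[OF iid[unfolded m] I(1) a \<delta>0 s0])
        fix w assume w: "w \<in> I"
        show "c w > 0" using c I(2)[OF w] by blast
        show "real (Suc m) * (\<delta> * s) \<le> c w / 2" using Ne small[OF w] unfolding m by linarith
        show "c w * norm1 x \<le> norm1 (lower_toeplitz k a b (l w) *\<^sub>v x)" if "x \<in> carrier_vec k" for k x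
          using lower[OF I(2)[OF w] that, of "l w"] c[OF I(2)[OF w]] by simp
      qed (use \<tau> in auto)
      thus thesis unfolding m[symmetric] using that unfolding A_def by blast
    qed
    have count: "real (eigenvalue_count (A \<omega>) (- \<Gamma>)) \<le> C * P * ln (real N)" if \<omega>: "\<omega> \<in> F" for \<omega>
    proof -
      have Q: "Q \<omega> \<in> carrier_mat N N"
        using iid \<omega> sets.sets_into_space[OF F] unfolding iid_complex_gaussian_matrix_def by auto
      have A: "A \<omega> \<in> carrier_mat N N" unfolding A_def using Q by auto
      have E: "complex_of_real \<delta> \<cdot>\<^sub>m Q \<omega> \<in> carrier_mat N N" using Q by simp
      have E_le: "cmod ((complex_of_real \<delta> \<cdot>\<^sub>m Q \<omega>) $$ (i, j)) \<le> \<delta> * s" if "i < N" "j < N" for i j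
        using Q that q[OF \<omega> that] \<delta>0 by (simp add: norm_mult)
      have "spectrum (A \<omega>) \<inter> - \<Gamma> \<subseteq> (\<Union>w\<in>I. cball (l w) (c w / 3))"
      proof
        fix z assume z: "z \<in> spectrum (A \<omega>) \<inter> - \<Gamma>"
        obtain w where w: "z = l w" "cmod w \<le> 1 + real N * (\<delta> * s) / (cmod a - cmod b)"
          using eigenvalue_near_filled_ellipse[OF ab E E_le, of z] z unfolding A_def l_def by auto
        have "real N * (\<delta> * s) / (cmod a - cmod b) \<le> \<eta>"
          using Ne near ab by (simp add: pos_divide_le_eq)
        hence "cmod w \<le> 1 + \<eta>" using w(2) by linarith
        thus "z \<in> (\<Union>w\<in>I. cball (l w) (c w / 3))" using cover[of w] z w(1) by auto
      qed
      from eigenvalue_count_le_cover[OF A I(1) this]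
      have "real (eigenvalue_count (A \<omega>) (- \<Gamma>)) \<le> (\<Sum>w\<in>I. real (eigenvalue_count (A \<omega>) (cball (l w) (c w / 3))))"
        by (metis of_nat_le_iff of_nat_sum)
      also have "\<dots> \<le> (\<Sum>w\<in>I. (\<bar>ln (L w)\<bar> + 1) / ln 2 * (P * ln (real N)))"
      proof (rule sum_mono)
        fix w assume w: "w \<in> I"
        have cw: "c w > 0" using c I(2) w by blast
        define n where "n = eigenvalue_count (A \<omega>) (cball (l w) (c w / 3))"
        \<comment> \<open>The powers of |a| cancel against those in \<tau>, so taking logarithms
          leaves n ln 2 <= P + ln (L w).\<close>
        have "2 ^ n * \<tau> \<le> cmod a ^ N * L w" unfolding n_def
        proof (rule eigenvalue_count_cball_le[OF A cw \<tau> det[OF \<omega> w]])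
          fix z assume z: "z \<in> cball (l w) (c w)"
          have "cmod (Determinant.det (A \<omega> - z \<cdot>\<^sub>m 1\<^sub>m N))
            \<le> cmod a ^ Suc N * (1 + (1 + cmod a) / c w) * (1 + real N * (\<delta> * s) / c w) ^ N"
            unfolding A_def
          proof (rule cmod_det_bidiag_toeplitz_le[OF E cw E_le])
            show "c w * norm1 x \<le> norm1 (lower_toeplitz k a b z *\<^sub>v x)" if "x \<in> carrier_vec k" for k x
              using z by (intro lower[OF I(2)[OF w] that]) (simp add: dist_norm norm_minus_commute)
          qed auto
          also have "\<dots> \<le> cmod a ^ Suc N * (1 + (1 + cmod a) / c w) * exp (2 * C\<^sub>0 / c w)"
            using expU[OF w] cw by (intro mult_left_mono) auto
          finally show "cmod (Determinant.det (A \<omega> - z \<cdot>\<^sub>m 1\<^sub>m N)) \<le> cmod a ^ N * L w"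
            unfolding L_def by (simp add: mult_ac)
        qed
        hence "2 ^ n * exp (- P) \<le> L w" unfolding \<tau>_def using a by (simp add: mult_ac)
        hence n: "2 ^ n \<le> L w * exp P" by (simp add: exp_minus field_simps)
        have Lw: "L w > 0" unfolding L_def using a cw by (intro mult_pos_pos add_pos_nonneg) auto
        have "real n * ln 2 = ln (2 ^ n)" by (simp add: ln_realpow)
        also have "\<dots> \<le> ln (L w * exp P)" using n Lw by (subst ln_le_cancel_iff) auto
        also have "\<dots> = ln (L w) + P" using Lw by (simp add: ln_mult)
        also have "\<dots> \<le> (\<bar>ln (L w)\<bar> + 1) * P"
        proof -
          have "ln (L w) \<le> \<bar>ln (L w)\<bar> * P" using mult_left_mono[OF P1, of "\<bar>ln (L w)\<bar>"] by simp
          thus ?thesis by (simp add: algebra_simps)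
        qed
        also have "\<dots> \<le> (\<bar>ln (L w)\<bar> + 1) * (P * ln (real N))"
          using mult_left_mono[OF lnN, of P] P1 by (intro mult_left_mono) auto
        finally show "real n \<le> (\<bar>ln (L w)\<bar> + 1) / ln 2 * (P * ln (real N))"
          by (simp add: field_simps)
      qed
      also have "\<dots> = C1 * (P * ln (real N))" unfolding C1_def by (simp add: sum_distrib_right)
      also have "\<dots> \<le> C * (P * ln (real N))"
        unfolding C_def using C12 P1 lnN by (intro mult_right_mono) auto
      finally show ?thesis by (simp add: mult_ac)
    qed
    have "2 * (real N)\<^sup>2 * exp (- s\<^sup>2 / 2)
        + (\<Sum>w\<in>I. (\<tau> * (1 + 2 * real N * (\<delta> * s) / c w) ^ N / (\<delta> * cmod a ^ m))\<^sup>2)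
      \<le> C * ln (real N) * real N powr (2 * \<kappa>) * exp (- 2 * P)"
    proof -
      define R where "R = real N powr (2 * \<kappa>) * exp (- 2 * P)"
      have R0: "R \<ge> 0" unfolding R_def by simp
      \<comment> \<open>The number N^2 of tail events is absorbed into N^(2 kappa).\<close>
      have "(real N)\<^sup>2 = real N powr 2" using N3 by (simp add: powr_numeral)
      also have "\<dots> \<le> real N powr (2 * \<kappa>)" using N3 \<kappa> by (intro powr_mono) auto
      finally have "2 * (real N)\<^sup>2 * exp (- s\<^sup>2 / 2) \<le> 2 * R"
        unfolding R_def using s2 by simp
      moreover have "(\<Sum>w\<in>I. (\<tau> * (1 + 2 * real N * (\<delta> * s) / c w) ^ N / (\<delta> * cmod a ^ m))\<^sup>2) \<le> C2 * R"
        unfolding C2_def sum_distrib_right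
      proof (rule sum_mono)
        fix w assume w: "w \<in> I"
        have cw: "c w > 0" using c I(2) w by blast
        \<comment> \<open>The slope of the determinant is proportional to \<delta>; squaring this
          bound on 1 / \<delta> produces the factor N^(2 kappa).\<close>
        have inv: "1 / \<delta> \<le> C\<^sub>0 * real N powr \<kappa>"
        proof -
          have "1 / \<delta> \<le> 1 / (inverse C\<^sub>0 * real N powr (- \<kappa>))"
            using \<delta>(1) \<delta>0 C0 N3 by (intro divide_left_mono) auto
          also have "\<dots> = C\<^sub>0 * real N powr \<kappa>" using N3 C0 by (simp add: powr_minus field_simps)
          finally show ?thesis .
        qed
        have "\<tau> * (1 + 2 * real N * (\<delta> * s) / c w) ^ N / (\<delta> * cmod a ^ m)
          = cmod a * exp (- P) * ((1 + 2 * real N * (\<delta> * s) / c w) ^ N * (1 / \<delta>))"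
          unfolding \<tau>_def using a by (simp add: m)
        also have "\<dots> \<le> cmod a * exp (- P) * (exp (4 * C\<^sub>0 / c w) * (C\<^sub>0 * real N powr \<kappa>))"
          using expL[OF w] inv \<delta>0 by (intro mult_left_mono mult_mono) auto
        finally have le: "\<tau> * (1 + 2 * real N * (\<delta> * s) / c w) ^ N / (\<delta> * cmod a ^ m) \<le> \<dots>" .
        have "0 \<le> \<tau> * (1 + 2 * real N * (\<delta> * s) / c w) ^ N / (\<delta> * cmod a ^ m)"
          using \<tau> \<delta>0 s0 cw
          by (intro divide_nonneg_nonneg mult_nonneg_nonneg zero_le_power add_nonneg_nonneg) (auto simp: mult.assoc)
        from power_mono[OF le this, of 2]
        have "(\<tau> * (1 + 2 * real N * (\<delta> * s) / c w) ^ N / (\<delta> * cmod a ^ m))\<^sup>2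
          \<le> (cmod a * exp (- P) * (exp (4 * C\<^sub>0 / c w) * (C\<^sub>0 * real N powr \<kappa>)))\<^sup>2" .
        also have "\<dots> = (cmod a * exp (4 * C\<^sub>0 / c w) * C\<^sub>0)\<^sup>2 * ((real N powr \<kappa>)\<^sup>2 * (exp (- P))\<^sup>2)"
          by (simp add: power_mult_distrib mult_ac)
        also have "(real N powr \<kappa>)\<^sup>2 = real N powr (2 * \<kappa>)"
          by (simp add: power2_eq_square flip: powr_add)
        also have "(exp (- P))\<^sup>2 = exp (- 2 * P)" by (simp add: power2_eq_square flip: exp_add)
        finally show "(\<tau> * (1 + 2 * real N * (\<delta> * s) / c w) ^ N / (\<delta> * cmod a ^ m))\<^sup>2
          \<le> (cmod a * exp (4 * C\<^sub>0 / c w) * C\<^sub>0)\<^sup>2 * R" unfolding R_def .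
      qed
      moreover have "2 * R + C2 * R \<le> C * R" unfolding C_def using C12 R0 by (simp add: algebra_simps)
      moreover have "C * R \<le> C * R * ln (real N)"
        using mult_left_mono[OF lnN, of "C * R"] R0 C12 unfolding C_def by simp
      ultimately show ?thesis unfolding R_def by (simp add: mult_ac)
    qed
    hence "1 - C * ln (real N) * real N powr (2 * \<kappa>) * exp (- 2 * P) \<le> prob F" using prob by linarith
    thus ?thesis unfolding holds_with_prob_ge_def using F count unfolding A_def P_def by blast
  qed
  moreover have "C > 0" unfolding C_def using C12 by simp
  ultimately show ?thesis by blast
qed

theorem corollary1p2:
  fixes a b :: complex and \<kappa> C\<^sub>0 \<delta>\<^sub>0 :: real and \<Gamma> :: "complex set"
  assumes "0 < norm b" and "norm b < norm a"
    and "\<kappa> > 5 / 2"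
    and "C\<^sub>0 \<ge> 1"
    and "\<delta>\<^sub>0 > 0"
    and "symbol_ellipse a b \<subseteq> interior \<Gamma>"
  shows "\<exists>C::real. C > 0 \<and> (\<exists>N\<^sub>0::nat. \<forall>N\<ge>N\<^sub>0.
           \<forall>(\<delta>::real) (M :: 'w measure) (Q :: 'w \<Rightarrow> complex mat).
             inverse C\<^sub>0 * real N powr (- \<kappa>) \<le> \<delta> \<and> \<delta> \<le> C\<^sub>0 * real N powr (- \<kappa>) \<longrightarrow>
             iid_complex_gaussian_matrix M N Q \<longrightarrow>
             holds_with_prob_ge M
               (1 - C * ln (real N) * real N powr (2 * \<kappa>) * exp (- 2 * real N powr \<delta>\<^sub>0))
               (\<lambda>\<omega>. real (eigenvalue_count
                        (bidiag_toeplitz N a b + complex_of_real \<delta> \<cdot>\<^sub>m Q \<omega>) (- \<Gamma>))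
                      \<le> C * real N powr \<delta>\<^sub>0 * ln (real N)))"
proof (cases "\<delta>\<^sub>0 < 1")
  case True
  show ?thesis by (rule eigenvalue_count_ellipse_bound) (use assms True in auto)
next
  \<comment> \<open>For exponents at least 1 there are at most N <= N^delta_0 ln N eigenvalues in
    all, so the whole space serves as the event.\<close>
  case False
  have "holds_with_prob_ge M
      (1 - 1 * ln (real N) * real N powr (2 * \<kappa>) * exp (- 2 * real N powr \<delta>\<^sub>0))
      (\<lambda>\<omega>. real (eigenvalue_count (bidiag_toeplitz N a b + complex_of_real \<delta> \<cdot>\<^sub>m Q \<omega>) (- \<Gamma>))
        \<le> 1 * real N powr \<delta>\<^sub>0 * ln (real N))"
    if N: "N \<ge> 3" and iid: "iid_complex_gaussian_matrix M N Q"
    for N \<delta> and M :: "'w measure" and Q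
  proof -
    interpret prob_space M using iid unfolding iid_complex_gaussian_matrix_def by blast
    have "exp 1 \<le> real N" using exp_le N by (meson numeral_le_real_of_nat_iff order.trans)
    hence lnN: "ln (real N) \<ge> 1" using N by (subst ln_ge_iff) auto
    have "real (eigenvalue_count (bidiag_toeplitz N a b + complex_of_real \<delta> \<cdot>\<^sub>m Q \<omega>) (- \<Gamma>))
        \<le> 1 * real N powr \<delta>\<^sub>0 * ln (real N)" if "\<omega> \<in> space M" for \<omega>
    proof -
      have "bidiag_toeplitz N a b + complex_of_real \<delta> \<cdot>\<^sub>m Q \<omega> \<in> carrier_mat N N"
        using iid that unfolding iid_complex_gaussian_matrix_def by auto
      from eigenvalue_count_le_dim[OF this, of "- \<Gamma>"]
      have "real (eigenvalue_count (bidiag_toeplitz N a b + complex_of_real \<delta> \<cdot>\<^sub>m Q \<omega>) (- \<Gamma>)) \<le> real N powr 1 * 1"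
        using N by simp
      also have "\<dots> \<le> real N powr \<delta>\<^sub>0 * ln (real N)"
        using N False lnN by (intro mult_mono powr_mono) auto
      finally show ?thesis by simp
    qed
    moreover have "1 - 1 * ln (real N) * real N powr (2 * \<kappa>) * exp (- 2 * real N powr \<delta>\<^sub>0) \<le> prob (space M)"
      using lnN by (simp add: prob_space)
    ultimately show ?thesis unfolding holds_with_prob_ge_def by blast
  qed
  thus ?thesis by (intro exI[of _ 1] conjI exI[of _ 3]) auto
qed

end
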